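(* Let $n\ge 1$, let $k_1,\ldots,k_n$ be non-negative integers and $m=\sum_{i=1}^n k_i$. Let $u:\mathbb{D}^n\to\mathbb{C}$ be a nonzero analytic function and let $v:\mathbb{D}^n\to\mathbb{D}^n$, $v(z_1,\ldots,z_n)=(v_1(z_1),\ldots,v_n(z_n))$, be an analytic self-map of $\mathbb{D}^n$ such that $W_{u,v,k_1,\ldots,k_n}$ is bounded on $H^2(\mathbb{D}^n)$. Then $W_{u,v,k_1,\ldots,k_n}$ is $\mathcal{J}$-symmetric if and only if $$u(z_1,\ldots,z_n)=a\prod_{i=1}^{n}\frac{z_i^{k_i}}{(1-c_iz_i)^{k_i+1}}\quad\text{and}\quad v_j(z_j)=\frac{(d_j-c_j^2)z_j+c_j}{1-c_jz_j}\quad\text{for } j=1,\ldots,n,$$ where $a=\frac{\partial^{m}u}{\partial z_1^{k_1}\partial z_2^{k_2}\cdots\partial z_n^{k_n}}(0,\ldots,0)$, $c_j=v_j(0)$ and $d_j=v_j'(0)$ for $j=1,\ldots,n$.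
   Context: $\mathbb{D}$ is the open unit disk in $\mathbb{C}$, $\mathbb{D}^n$ the polydisk, $\mathbb{T}^n$ the torus with normalized Haar measure $\sigma$. $H^2(\mathbb{D}^n)$ is the Hardy space of analytic $f:\mathbb{D}^n\to\mathbb{C}$ with $\|f\|^2=\sup_{0<r<1}\int_{\mathbb{T}^n}|f(r\zeta)|^2\,d\sigma(\zeta)<\infty$; it is a Hilbert space in which the monomials $\prod_i z_i^{m_i}$ ($m_i\ge 0$) form an orthonormal basis. In $v=(v_1,\ldots,v_n)$ each $v_j$ is an analytic self-map of $\mathbb{D}$ depending only on $z_j$. "Nonzero" means not identically zero. The weighted composition-differentiation operator is $W_{u,v,k_1,\ldots,k_n}f(z)=u(z)\,\frac{\partial^{m}f}{\partial z_1^{k_1}\cdots\partial z_n^{k_n}}(v(z))$ with $m=\sum_{i=1}^n k_i$. The standard conjugation on $H^2(\mathbb{D}^n)$ is $\mathcal{J}f(z)=\overline{f(\bar z)}$, where $\bar z=(\bar z_1,\ldots,\bar z_n)$. A bounded operator $T$ is $\mathcal{J}$-symmetric (complex symmetric with conjugation $\mathcal{J}$) if $T=\mathcal{J}T^*\mathcal{J}$.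
   Formalization: The constant a is taken to be the mixed partial derivative of u at 0 divided by k_1!...k_n!; as printed, without this factor, the claim fails when some k_i >= 2 (e.g. n=1, k=2, u=z^2, v=z/2). It is unchanged when all k_i <= 1. *)

theory Defs
  imports "HOL-Probability.Probability" "HOL-Complex_Analysis.Complex_Analysis"
begin

definition polydisk :: "(complex ^ 'n) set" where
  "polydisk = {z. \<forall>i. z $ i \<in> ball 0 1}"

definition upd :: "complex ^ 'n \<Rightarrow> 'n \<Rightarrow> complex \<Rightarrow> complex ^ 'n" where
  "upd z i w = (\<chi> j. if j = i then w else z $ j)"

text \<open>Analyticity in several variables as in Rudin's \<^emph>\<open>Function Theory in Polydiscs\<close>: joint continuity
  together with holomorphy in each variable separately.\<close>

definition analytic_polydisk :: "(complex ^ 'n::finite \<Rightarrow> complex) \<Rightarrow> bool" where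
  "analytic_polydisk f \<longleftrightarrow> continuous_on polydisk f \<and>
     (\<forall>z\<in>polydisk. \<forall>i. (\<lambda>w. f (upd z i w)) holomorphic_on ball 0 1)"

definition partial_deriv :: "'n \<Rightarrow> (complex ^ 'n \<Rightarrow> complex) \<Rightarrow> complex ^ 'n \<Rightarrow> complex" where
  "partial_deriv i f z = deriv (\<lambda>w. f (upd z i w)) (z $ i)"

text \<open>The coordinates are indexed by a linearly ordered finite type, so that the
  differentiations have a definite order; on analytic functions the order is immaterial.\<close>

definition mixed_partial ::
  "('n \<Rightarrow> nat) \<Rightarrow> (complex ^ 'n::{finite,linorder} \<Rightarrow> complex) \<Rightarrow> complex ^ 'n::{finite,linorder} \<Rightarrow> complex" where
  "mixed_partial k f = foldr (\<lambda>i. partial_deriv i ^^ k i) (sorted_list_of_set UNIV) f"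

definition circle_measure :: "complex measure" where
  "circle_measure = distr (uniform_measure lborel {0..2 * pi}) borel cis"

definition torus_measure :: "(complex ^ 'n::finite) measure" where
  "torus_measure = distr (Pi\<^sub>M UNIV (\<lambda>_. circle_measure)) borel vec_lambda"

definition hardy_norm_sq :: "(complex ^ 'n::finite \<Rightarrow> complex) \<Rightarrow> ennreal" where
  "hardy_norm_sq f =
     (SUP r\<in>{0<..<1::real}. \<integral>\<^sup>+ \<zeta>. ennreal ((cmod (f (r *\<^sub>R \<zeta>)))\<^sup>2) \<partial>torus_measure)"

text \<open>A function on the polydisk is represented by its extension by zero, so that equality of
  elements of the Hardy space is equality in HOL.\<close>

definition hardy_space :: "(complex ^ 'n::finite \<Rightarrow> complex) set" where
  "hardy_space =
     {f. analytic_polydisk f \<and> (\<forall>z. z \<notin> polydisk \<longrightarrow> f z = 0) \<and> hardy_norm_sq f < \<infinity>}"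

definition hardy_norm :: "(complex ^ 'n::finite \<Rightarrow> complex) \<Rightarrow> real" where
  "hardy_norm f = sqrt (enn2real (hardy_norm_sq f))"

text \<open>The inner product, linear in the first argument, that induces the norm (polarization).\<close>

definition hardy_inner ::
  "(complex ^ 'n::finite \<Rightarrow> complex) \<Rightarrow> (complex ^ 'n \<Rightarrow> complex) \<Rightarrow> complex" where
  "hardy_inner f g =
     (\<Sum>l<4. \<i> ^ l * complex_of_real ((hardy_norm (\<lambda>z. f z + \<i> ^ l * g z))\<^sup>2)) / 4"

text \<open>Linearity is not part of the following predicate; it is automatic for
  the operators \<open>weighted_comp_diff\<close> below.\<close>

definition hardy_bounded ::
  "((complex ^ 'n::finite \<Rightarrow> complex) \<Rightarrow> complex ^ 'n \<Rightarrow> complex) \<Rightarrow> bool" where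
  "hardy_bounded T \<longleftrightarrow> (\<forall>f\<in>hardy_space. T f \<in> hardy_space) \<and>
     (\<exists>C. \<forall>f\<in>hardy_space. hardy_norm (T f) \<le> C * hardy_norm f)"

definition hardy_adjoint ::
  "((complex ^ 'n::finite \<Rightarrow> complex) \<Rightarrow> complex ^ 'n \<Rightarrow> complex) \<Rightarrow>
   (complex ^ 'n \<Rightarrow> complex) \<Rightarrow> complex ^ 'n \<Rightarrow> complex" where
  "hardy_adjoint T g =
     (THE h. h \<in> hardy_space \<and> (\<forall>f\<in>hardy_space. hardy_inner (T f) g = hardy_inner f h))"

definition std_conjugation ::
  "(complex ^ 'n \<Rightarrow> complex) \<Rightarrow> complex ^ 'n \<Rightarrow> complex" where
  "std_conjugation f z = cnj (f (\<chi> i. cnj (z $ i)))"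

definition J_symmetric ::
  "((complex ^ 'n::finite \<Rightarrow> complex) \<Rightarrow> complex ^ 'n \<Rightarrow> complex) \<Rightarrow> bool" where
  "J_symmetric T \<longleftrightarrow>
     (\<forall>f\<in>hardy_space. T f = std_conjugation (hardy_adjoint T (std_conjugation f)))"

definition weighted_comp_diff ::
  "(complex ^ 'n::{finite,linorder} \<Rightarrow> complex) \<Rightarrow> (complex ^ 'n::{finite,linorder} \<Rightarrow> complex ^ 'n::{finite,linorder}) \<Rightarrow> ('n \<Rightarrow> nat) \<Rightarrow>
   (complex ^ 'n::{finite,linorder} \<Rightarrow> complex) \<Rightarrow> complex ^ 'n::{finite,linorder} \<Rightarrow> complex" where
  "weighted_comp_diff u v k f z = (if z \<in> polydisk then u z * mixed_partial k f (v z) else 0)"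

end

(*
  Identifying a function with its Taylor coefficients turns the Hardy space into a space of square
  summable families (Cauchy's formula on the torus and Parseval). Hence f \<mapsto> \<partial>^k f(w) is the inner product
  with an explicit kernel K^k_w, so T* K_w = cnj (u w) K^k_{v w}, and since the kernels K_w span a dense
  subspace, J-symmetry of T is equivalent to the identity
    u(z) \<Prod> w_i^k_i / (1 - v_i(z_i) w_i)^(k_i+1) = u(w) \<Prod> z_i^k_i / (1 - v_i(w_i) z_i)^(k_i+1).
  Dividing by the powers of w = (t,...,t) and letting t tend to 0 determines u; then fixing all variables but
  one and differentiating in w_j at 0 determines v_j. Conversely (1 - c z)(1 - v(z) w) is symmetric in
  z and w for the stated v.
*)
theory Submission
  imports Defs
begin

text \<open>The adjoint is a definite description. Its uniqueness comes from evaluation by Szego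
  kernels, its existence from explicit candidates: a multiple of a derivative kernel in one
  direction, the conjugate of T f in the other. Density of the kernels is used in the form that a
  bounded linear functional which vanishes on all of them is zero: on the kernels it is a power
  series whose coefficients are its values at monomials, and the Taylor partial sums of f converge
  to f in norm.

  The limit of u(t,...,t) / t^(k_1 + ... + k_n) that determines u is not known to exist beforehand;
  its existence is extracted from the identity itself at one fixed z without zero coordinates. The
  exponent k_j + 1 hides v_j inside a power; at w_j = 0 both bases have the same nonzero value, so
  after differentiation the common factor cancels.

  The divisor \<Prod> k_i! in \<open>a\<close> is forced: z^k has k-th derivative \<Prod> k_i! at 0,
  so \<open>a\<close> is the Taylor coefficient of u at z^k. For n = 1, k = 2, u = z^2, v = 0 the
  formula for u holds with a = 1, while the second derivative of u at 0 is 2.\<close>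

no_notation fps_nth (infixl "$" 75)

section \<open>Integration over the circle\<close>

definition mpow :: "complex ^ 'n::finite \<Rightarrow> ('n \<Rightarrow> nat) \<Rightarrow> complex" where
  "mpow z \<alpha> = (\<Prod>i\<in>UNIV. z $ i ^ \<alpha> i)"

text \<open>Distributivity of a finite product over absolutely convergent series. Every
  several-variable expansion below (Cauchy kernel, reproducing kernels) is assembled from
  one-variable factors in this way; the multi-indices are read as the full product
  \<open>PiE UNIV (\<lambda>_. UNIV)\<close>.\<close>

lemma has_sum_prod_UNIV:
  fixes f :: "'n::finite \<Rightarrow> nat \<Rightarrow> complex"
  assumes "\<And>i. (\<lambda>m. norm (f i m)) summable_on UNIV"
  shows "(\<lambda>\<alpha>. norm (\<Prod>i\<in>UNIV. f i (\<alpha> i))) summable_on UNIV" (is ?A)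
    and "((\<lambda>\<alpha>. \<Prod>i\<in>UNIV. f i (\<alpha> i)) has_sum (\<Prod>i\<in>UNIV. infsum (f i) UNIV)) UNIV"
proof -
  have PiE_U: "PiE UNIV (\<lambda>_::'n. UNIV) = (UNIV :: ('n \<Rightarrow> nat) set)"
    by (auto simp: PiE_def)
  have "Infinite_Set_Sum.abs_summable_on (\<lambda>\<alpha>. \<Prod>i\<in>UNIV. f i (\<alpha> i)) (PiE UNIV (\<lambda>_. UNIV))"
    by (rule abs_summable_on_prod_PiE) (use assms in \<open>auto simp: abs_summable_equivalent\<close>)
  thus A: ?A
    by (simp add: abs_summable_equivalent PiE_U)
  have "infsum (\<lambda>\<alpha>. \<Prod>i\<in>UNIV. f i (\<alpha> i)) (PiE UNIV (\<lambda>_. UNIV)) = (\<Prod>i\<in>UNIV. infsum (f i) UNIV)"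
    by (rule infsum_prod_PiE_abs) (use assms in auto)
  thus "((\<lambda>\<alpha>. \<Prod>i\<in>UNIV. f i (\<alpha> i)) has_sum (\<Prod>i\<in>UNIV. infsum (f i) UNIV)) UNIV"
    using A by (metis PiE_U abs_summable_summable has_sum_infsum)
qed

lemma prob_space_circle: "prob_space circle_measure"
  unfolding circle_measure_def
  by (intro prob_space.prob_space_distr prob_space_uniform_measure) 
     (auto simp: uniform_measure_def intro!: borel_measurable_continuous_onI continuous_intros)

text \<open>The interval integral enters as a \<open>has_integral\<close> fact because the
  fundamental theorem of calculus and contour integrals deliver that form; continuity along the
  circle makes it agree with the Lebesgue integral.\<close>

lemma circle_integral:
  assumes [measurable]: "g \<in> borel_measurable borel"
    and cont: "continuous_on {0..2*pi} (\<lambda>t. g (cis t))"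
    and I: "((\<lambda>t. g (cis t)) has_integral I) {0..2*pi}"
  shows "integral\<^sup>L circle_measure g = (I :: complex) / (2 * pi)"
proof -
  have [measurable]: "cis \<in> borel_measurable borel"
    by (intro borel_measurable_continuous_onI continuous_intros)
  have int: "set_integrable lborel {0..2*pi} (\<lambda>t. g (cis t))"
    by (rule borel_integrable_atLeastAtMost'[OF cont])
  have "integral\<^sup>L circle_measure g = (\<integral>t. g (cis t) \<partial>uniform_measure lborel {0..2*pi})"
    unfolding circle_measure_def by (subst integral_distr) auto
  also have "uniform_measure lborel {0..2*pi} = density lborel (\<lambda>t. ennreal (indicator {0..2*pi} t / (2 * pi)))"
    unfolding uniform_measure_def
    by (intro density_cong) (auto simp: indicator_def divide_ennreal simp flip: ennreal_1)
  also have "(\<integral>t. g (cis t) \<partial>\<dots>) = (\<integral>t. (indicator {0..2*pi} t / (2 * pi)) *\<^sub>R g (cis t) \<partial>lborel)"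
    by (rule integral_density) auto
  also have "\<dots> = (\<integral>t. (1 / (2 * pi)) *\<^sub>R (indicator {0..2*pi} t *\<^sub>R g (cis t)) \<partial>lborel)"
    by (intro arg_cong[where f = "integral\<^sup>L lborel"] ext) (simp add: scaleR_conv_of_real)
  also have "\<dots> = (1 / (2 * pi)) *\<^sub>R (LBINT t:{0..2*pi}. g (cis t))"
    by (simp only: set_lebesgue_integral_def integral_scaleR_right)
  also have "(LBINT t:{0..2*pi}. g (cis t)) = I"
    using set_borel_integral_eq_integral(2)[OF int] I by (simp add: integral_unique)
  finally show ?thesis by (simp add: scaleR_conv_of_real)
qed

lemma circle_integral_monomial:
  "(\<integral>\<zeta>. \<zeta> ^ m * cnj \<zeta> ^ l \<partial>circle_measure) = (if m = l then 1 else 0)"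
proof -
  have [measurable]: "cnj \<in> borel_measurable borel"
    by (intro borel_measurable_continuous_onI continuous_intros)
  have meas: "(\<lambda>\<zeta>::complex. \<zeta> ^ m * cnj \<zeta> ^ l) \<in> borel_measurable borel"
    by measurable
  have cis: "cis t ^ m * cnj (cis t) ^ l = cis ((real m - real l) * t)" for t
    by (simp add: Complex.DeMoivre cis_cnj cis_mult left_diff_distrib)
  have cont: "continuous_on {0..2*pi} (\<lambda>t. cis t ^ m * cnj (cis t) ^ l)"
    by (intro continuous_intros)
  show ?thesis
  proof (cases "m = l")
    case True
    have "((\<lambda>t. cis t ^ m * cnj (cis t) ^ l) has_integral of_real (2 * pi)) {0..2*pi}"
      unfolding cis using has_integral_const_real[of "1::complex" 0 "2*pi"] True
      by (simp add: scaleR_conv_of_real)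
    from circle_integral[OF meas cont this] True show ?thesis by simp
  next
    case False
    define q where "q = real m - real l"
    have q: "q \<noteq> 0" using False by (simp add: q_def)
    have "((\<lambda>t. cis (q * t)) has_integral
        (cis (q * (2*pi)) / (\<i> * q) - cis (q * 0) / (\<i> * q))) {0..2*pi}"
    proof (rule fundamental_theorem_of_calculus)
      fix t
      have "((\<lambda>t. exp (\<i> * of_real q * of_real t) / (\<i> * of_real q)) has_vector_derivative
          exp (\<i> * of_real q * of_real t)) (at t within {0..2*pi})"
        using q by (auto intro!: derivative_eq_intros has_vector_derivative_real_field)
      thus "((\<lambda>t. cis (q * t) / (\<i> * of_real q)) has_vector_derivative cis (q * t)) (at t within {0..2*pi})"
        by (simp add: cis_conv_exp mult_ac)
    qed simp
    also have "cis (q * (2*pi)) = 1"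
    proof -
      have "q * (2 * pi) = 2 * pi * of_int (int m - int l)" by (simp add: q_def)
      also have "cis \<dots> = 1" by (rule cis_multiple_2pi) simp
      finally show ?thesis .
    qed
    finally have "((\<lambda>t. cis t ^ m * cnj (cis t) ^ l) has_integral 0) {0..2*pi}"
      unfolding cis q_def[symmetric] by simp
    from circle_integral[OF meas cont this] False show ?thesis by simp
  qed
qed

text \<open>The measure lives on the whole plane, so estimates that rely on modulus 1 are available
  only almost everywhere. The same holds for the torus, hence the AE bounds throughout.\<close>

lemma AE_circle: "AE \<zeta> in circle_measure. cmod \<zeta> = 1"
proof -
  have [measurable]: "cis \<in> borel_measurable borel"
    by (intro borel_measurable_continuous_onI continuous_intros)
  show ?thesis unfolding circle_measure_def
    by (subst AE_distr_iff) auto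
qed

text \<open>With w = R \<zeta> the form dw / (w - z) becomes i dt / (1 - z cnj(\<zeta>) / R), which
  is ready for a geometric expansion in z. Measurability is a separate assumption because holomorphy
  says nothing about \<open>g\<close> off the disk.\<close>

lemma circle_Cauchy:
  assumes holo: "g holomorphic_on ball 0 1" and meas: "g \<in> borel_measurable borel"
    and R: "0 < R" "R < 1" and z: "cmod z < R"
  shows "(\<integral>\<zeta>. g (complex_of_real R * \<zeta>) / (1 - z * cnj \<zeta> / R) \<partial>circle_measure) = g z"
proof -
  have [measurable]: "cnj \<in> borel_measurable borel"
    by (intro borel_measurable_continuous_onI continuous_intros)
  note [measurable] = meas
  have ne: "1 - z * cnj (cis t) / R \<noteq> 0" for t
  proof
    assume "1 - z * cnj (cis t) / R = 0"
    hence "1 = z * cnj (cis t) / R" by simp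
    hence "cmod (1::complex) = cmod (z * cnj (cis t) / R)" by metis
    thus False using R z by (simp add: norm_mult norm_divide)
  qed
  have "((\<lambda>w. g w / (w - z)) has_contour_integral (2 * of_real pi * \<i> * g z)) (circlepath 0 R)"
    by (rule Cauchy_integral_circlepath_simple)
       (use R z in \<open>auto intro!: holomorphic_on_subset[OF holo]\<close>)
  hence "((\<lambda>w. g w / (w - z)) has_contour_integral (2 * of_real pi * \<i> * g z)) (part_circlepath 0 R 0 (2*pi))"
    by (simp add: circlepath_def)
  hence "((\<lambda>t. g (R * cis t) / (R * cis t - z) * R * \<i> * cis t) has_integral (2 * of_real pi * \<i> * g z)) {0..2*pi}"
    by (subst (asm) has_contour_integral_part_circlepath_iff) simp_all
  hence "((\<lambda>t. (1/\<i>) * (g (R * cis t) / (R * cis t - z) * R * \<i> * cis t)) has_integral (1/\<i>) * (2 * of_real pi * \<i> * g z)) {0..2*pi}"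
    by (rule has_integral_mult_right)
  moreover have "(1/\<i>) * (g (R * cis t) / (R * cis t - z) * R * \<i> * cis t) 
      = g (R * cis t) / (1 - z * cnj (cis t) / R)" for t
  proof -
    have "cis t * cnj (cis t) = 1"
      by (simp add: cis_cnj cis_mult)
    hence "(R * cis t - z) = R * cis t * (1 - z * cnj (cis t) / R)"
      using R by (simp add: field_simps)
    thus ?thesis using R ne[of t] by (simp only: ) (simp add: field_simps)
  qed
  ultimately have I: "((\<lambda>t. g (R * cis t) / (1 - z * cnj (cis t) / R)) has_integral 2 * pi * g z) {0..2*pi}"
    by (simp add: mult_ac)
  have "continuous_on {0..2*pi} (\<lambda>t. g (R * cis t))"
    by (rule continuous_on_compose2[OF holomorphic_on_imp_continuous_on[OF holo]])
       (use R in \<open>auto intro!: continuous_intros simp: norm_mult\<close>)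
  hence "continuous_on {0..2*pi} (\<lambda>t. g (R * cis t) / (1 - z * cnj (cis t) / R))"
    using ne R by (intro continuous_intros) auto
  from circle_integral[OF _ this I] show ?thesis by simp
qed

section \<open>Integration over the torus\<close>

lemma polydisk_iff: "z \<in> polydisk \<longleftrightarrow> (\<forall>i. cmod (z $ i) < 1)"
  by (simp add: polydisk_def)

lemma upd_nth [simp]: "upd z i w $ j = (if j = i then w else z $ j)"
  by (simp add: upd_def)

lemma upd_same [simp]: "upd z i (z $ i) = z"
  by (simp add: vec_eq_iff)

lemma upd_in_polydisk: "z \<in> polydisk \<Longrightarrow> cmod w < 1 \<Longrightarrow> upd z i w \<in> polydisk"
  by (simp add: polydisk_iff)

lemma open_polydisk: "open (polydisk :: (complex ^ 'n::finite) set)"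
proof -
  have "open (\<Inter>i\<in>UNIV. {z :: complex ^ 'n. cmod (z $ i) < 1})"
    by (intro open_INT finite ballI open_Collect_less continuous_intros)
  also have "(\<Inter>i\<in>UNIV. {z :: complex ^ 'n. cmod (z $ i) < 1}) = polydisk"
    by (auto simp: polydisk_iff)
  finally show ?thesis .
qed

lemma borel_measurable_vec:
  fixes g :: "'a \<Rightarrow> 'n::finite \<Rightarrow> complex"
  assumes "\<And>i. (\<lambda>x. g x i) \<in> borel_measurable M"
  shows "(\<lambda>x. \<chi> i. g x i) \<in> borel_measurable M"
proof (subst borel_measurable_euclidean_space, intro ballI)
  fix b :: "complex ^ 'n" assume "b \<in> Basis"
  then obtain i c where b: "b = axis i c" "c \<in> Basis" by (auto simp: Basis_vec_def)
  show "(\<lambda>x. (\<chi> i. g x i) \<bullet> b) \<in> borel_measurable M"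
    using assms[of i] by (simp add: b inner_axis)
qed

lemma measurable_vec_lambda [measurable]:
  "vec_lambda \<in> measurable (PiM UNIV (\<lambda>_::'n::finite. circle_measure)) (borel :: (complex ^ 'n) measure)"
proof (rule borel_measurable_vec)
  fix i :: 'n
  have "(\<lambda>x. x i) \<in> measurable (PiM UNIV (\<lambda>_::'n. circle_measure)) circle_measure"
    by measurable
  thus "(\<lambda>x. x i) \<in> borel_measurable (PiM UNIV (\<lambda>_::'n. circle_measure))"
    by (simp add: circle_measure_def cong: measurable_cong_sets)
qed

lemma sets_torus [simp, measurable_cong]: "sets torus_measure = sets borel"
  by (simp add: torus_measure_def)

lemma space_torus [simp]: "space torus_measure = UNIV"
  by (simp add: torus_measure_def)

interpretation circle: prob_space circle_measure
  by (rule prob_space_circle)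

interpretation torus: prob_space "torus_measure :: (complex ^ 'n::finite) measure"
  unfolding torus_measure_def
  by (intro prob_space.prob_space_distr prob_space_PiM prob_space_circle measurable_vec_lambda)

lemma integral_torus:
  fixes F :: "complex ^ 'n::finite \<Rightarrow> complex"
  assumes "F \<in> borel_measurable borel"
  shows "integral\<^sup>L torus_measure F = (\<integral>x. F (vec_lambda x) \<partial>PiM UNIV (\<lambda>_::'n. circle_measure))"
  unfolding torus_measure_def using assms by (subst integral_distr) auto

lemma AE_torus: "AE \<zeta> in torus_measure. \<forall>i::'n::finite. cmod (\<zeta> $ i) = 1"
proof -
  have "AE x in PiM UNIV (\<lambda>_::'n. circle_measure). \<forall>i::'n. cmod (x i) = 1"
    by (intro AE_all_countable[THEN iffD2] allI AE_PiM_component AE_circle prob_space_circle) auto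
  moreover have "{\<zeta> :: complex ^ 'n. \<forall>i. cmod (\<zeta> $ i) = 1} \<in> sets borel"
    by (intro borel_closed closed_Collect_all closed_Collect_eq continuous_intros)
  ultimately show ?thesis unfolding torus_measure_def by (subst AE_distr_iff) auto
qed

lemma borel_mpow [measurable]: "(\<lambda>z::complex ^ 'n::finite. mpow z \<alpha>) \<in> borel_measurable borel"
  unfolding mpow_def by (intro borel_measurable_continuous_onI continuous_intros)

lemma borel_cnj [measurable]: "cnj \<in> borel_measurable borel"
  by (intro borel_measurable_continuous_onI continuous_intros)

lemma norm_mpow: "cmod (mpow z \<alpha>) = (\<Prod>i\<in>UNIV. cmod (z $ i) ^ \<alpha> i)"
  by (simp add: mpow_def prod_norm[symmetric] norm_power)

lemma norm_mpow_torus: "\<forall>i. cmod (z $ i) = 1 \<Longrightarrow> cmod (mpow z \<alpha>) = 1"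
  by (simp add: norm_mpow)

lemma mpow_scaleR: "mpow (r *\<^sub>R z) \<alpha> = of_real (r ^ sum \<alpha> UNIV) * mpow z \<alpha>"
proof -
  have "(\<Prod>i\<in>UNIV. (r *\<^sub>R z) $ i ^ \<alpha> i) = (\<Prod>i\<in>UNIV. of_real r ^ \<alpha> i * z $ i ^ \<alpha> i)"
    by (simp only: vector_scaleR_component scaleR_conv_of_real[where 'a = complex] power_mult_distrib)
  thus ?thesis by (simp add: mpow_def prod.distrib power_sum)
qed

lemma torus_integral_monomial:
  "(\<integral>\<zeta>. mpow \<zeta> \<alpha> * cnj (mpow \<zeta> \<beta>) \<partial>torus_measure) = (if \<alpha> = \<beta> then 1 else 0)"
proof -
  interpret product_sigma_finite "\<lambda>_::'a. circle_measure"
    by (simp add: product_sigma_finite_def circle.sigma_finite_measure_axioms)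
  have int: "integrable circle_measure (\<lambda>\<zeta>. \<zeta> ^ m * cnj \<zeta> ^ l)" for m l
  proof (rule circle.integrable_const_bound)
    show "AE \<zeta> in circle_measure. cmod (\<zeta> ^ m * cnj \<zeta> ^ l) \<le> 1"
      using AE_circle by eventually_elim (simp add: norm_mult norm_power)
  qed (simp add: circle_measure_def)
  have "(\<lambda>\<zeta>::complex ^ 'a. mpow \<zeta> \<alpha> * cnj (mpow \<zeta> \<beta>)) \<in> borel_measurable borel"
    by measurable
  hence "(\<integral>\<zeta>. mpow \<zeta> \<alpha> * cnj (mpow \<zeta> \<beta>) \<partial>torus_measure) =
     (\<integral>x. (\<Prod>i\<in>UNIV. x i ^ \<alpha> i * cnj (x i) ^ \<beta> i) \<partial>PiM UNIV (\<lambda>_. circle_measure))"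
    by (subst integral_torus) (simp_all add: mpow_def prod.distrib)
  also have "\<dots> = (\<Prod>i\<in>UNIV. if \<alpha> i = \<beta> i then 1 else 0)"
    by (subst product_integral_prod) (auto simp: int circle_integral_monomial)
  also have "\<dots> = (if \<alpha> = \<beta> then 1 else 0)"
    by (auto simp: fun_eq_iff)
  finally show ?thesis .
qed

text \<open>Termwise integration of a series over multi-indices. On a probability space a constant
  bound on each term also bounds its integral, so one summable family \<open>B\<close> controls both
  the pointwise series and the series of integrals.\<close>

lemma (in prob_space) integral_has_sum:
  fixes f :: "('n::finite \<Rightarrow> nat) \<Rightarrow> 'a \<Rightarrow> complex"
  assumes [measurable]: "\<And>\<alpha>. f \<alpha> \<in> borel_measurable M" "g \<in> borel_measurable M"
    and le: "AE x in M. \<forall>\<alpha>. cmod (f \<alpha> x) \<le> B \<alpha>"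
    and B: "B summable_on UNIV"
    and g: "AE x in M. ((\<lambda>\<alpha>. f \<alpha> x) has_sum g x) UNIV"
  shows "((\<lambda>\<alpha>. integral\<^sup>L M (f \<alpha>)) has_sum integral\<^sup>L M g) UNIV"
proof -
  have "infinite (UNIV :: ('n \<Rightarrow> nat) set)"
    by (simp add: finite_UNIV_fun)
  \<comment> \<open>Multi-indices form a countable infinite set; enumerating them reduces the claim
    to termwise integration of a sequence.\<close>
  then obtain h :: "nat \<Rightarrow> 'n \<Rightarrow> nat" where h: "bij h"
    using countableE_infinite[of "UNIV :: ('n \<Rightarrow> nat) set"] bij_betw_inv_into by (metis uncountable_def countable_subset subset_UNIV countableI_type)
  have B': "(\<lambda>n. B (h n)) summable_on UNIV"
    using summable_on_reindex_bij_betw[OF h, of B] B by simp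
  have le': "AE x in M. \<forall>n. norm (f (h n) x) \<le> B (h n)"
    using le by eventually_elim auto
  have sB: "summable (\<lambda>n. B (h n))"
    by (rule summable_on_imp_summable[OF B'])
  have int: "integrable M (f \<alpha>)" for \<alpha>
    by (rule integrable_const_bound[of _ "B \<alpha>"]) (use le in \<open>eventually_elim, auto\<close>)
  have nint: "(\<integral>x. norm (f \<alpha> x) \<partial>M) \<le> B \<alpha>" for \<alpha>
  proof -
    have "(\<integral>x. norm (f \<alpha> x) \<partial>M) \<le> (\<integral>x. B \<alpha> \<partial>M)"
      by (rule integral_mono_AE) (use int le in \<open>auto elim!: eventually_mono\<close>)
    thus ?thesis by (simp add: prob_space)
  qed
  have summ: "summable (\<lambda>n. \<integral>x. norm (f (h n) x) \<partial>M)"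
    by (rule summable_comparison_test'[OF sB, of 0]) (use nint in simp)
  have "(\<lambda>n. integral\<^sup>L M (f (h n))) sums (\<integral>x. (\<Sum>n. f (h n) x) \<partial>M)"
  proof (rule sums_integral)
    show "AE x in M. summable (\<lambda>n. norm (f (h n) x))"
      using le' by eventually_elim (auto intro: summable_comparison_test'[OF sB, of 0])
  qed (use int summ in auto)
  also have "(\<integral>x. (\<Sum>n. f (h n) x) \<partial>M) = integral\<^sup>L M g"
  proof (rule integral_cong_AE)
    show "AE x in M. (\<Sum>n. f (h n) x) = g x"
      using g
    proof eventually_elim
      case (elim x)
      hence "((\<lambda>n. f (h n) x) has_sum g x) UNIV"
        using has_sum_reindex_bij_betw[OF h, of "\<lambda>\<alpha>. f \<alpha> x"] by simp
      thus ?case by (metis has_sum_imp_sums sums_unique)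
    qed
  qed auto
  finally have "(\<lambda>n. integral\<^sup>L M (f (h n))) sums integral\<^sup>L M g" .
  \<comment> \<open>\<open>sums\<close> depends on the enumeration; absolute convergence is what
    permits the return to an unordered sum.\<close>
  moreover have "summable (\<lambda>n. norm (integral\<^sup>L M (f (h n))))"
    by (rule summable_comparison_test'[OF summ, of 0]) simp
  ultimately have "((\<lambda>n. integral\<^sup>L M (f (h n))) has_sum integral\<^sup>L M g) UNIV"
    by (intro norm_summable_imp_has_sum)
  thus ?thesis
    using has_sum_reindex_bij_betw[OF h, of "\<lambda>\<alpha>. integral\<^sup>L M (f \<alpha>)"] by simp
qed

section \<open>Power series expansion on the polydisk\<close>

lemma borel_vec_nth [measurable]: "(\<lambda>x :: complex ^ 'n::finite. x $ i) \<in> borel_measurable borel"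
  by (intro borel_measurable_continuous_onI continuous_intros)

text \<open>The convention of \<open>hardy_space\<close> without the norm condition. Extension by
  zero makes these functions Borel on the whole space, so they can be integrated without restricting
  the domain.\<close>

definition analytic0 :: "(complex ^ 'n::finite \<Rightarrow> complex) \<Rightarrow> bool" where
  "analytic0 f \<longleftrightarrow> analytic_polydisk f \<and> (\<forall>z. z \<notin> polydisk \<longrightarrow> f z = 0)"

lemma analytic0_borel:
  assumes "analytic0 f" shows "f \<in> borel_measurable borel"
proof -
  have "(\<lambda>x. indicator polydisk x *\<^sub>R f x) \<in> borel_measurable borel"
    using assms by (intro borel_measurable_continuous_on_indicator)
      (auto simp: analytic0_def analytic_polydisk_def intro: borel_open open_polydisk)
  also have "(\<lambda>x. indicator polydisk x *\<^sub>R f x) = f"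
    using assms by (auto simp: analytic0_def indicator_def fun_eq_iff)
  finally show ?thesis .
qed

lemma analytic0_bounded:
  fixes f :: "complex ^ 'n::finite \<Rightarrow> complex"
  assumes f: "analytic0 f" and R: "R < 1"
  obtains B where "B \<ge> 0" "\<And>z. (\<And>i. cmod (z $ i) \<le> R) \<Longrightarrow> cmod (f z) \<le> B"
proof -
  let ?K = "{z :: complex ^ 'n. \<forall>i. cmod (z $ i) \<le> R}"
  have "closed ?K"
    by (intro closed_Collect_all closed_Collect_le continuous_intros)
  moreover have "bounded ?K"
  proof (rule boundedI)
    fix z :: "complex ^ 'n" assume "z \<in> ?K"
    hence "(\<Sum>i\<in>UNIV. cmod (z $ i)) \<le> (\<Sum>i\<in>(UNIV::'n set). R)" by (intro sum_mono) auto
    thus "norm z \<le> real CARD('n) * R"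
      unfolding norm_vec_def using L2_set_le_sum[of UNIV "\<lambda>i. cmod (z $ i)"] by simp
  qed
  ultimately have "compact ?K" by (simp add: compact_eq_bounded_closed)
  moreover have "?K \<subseteq> polydisk" using R by (fastforce simp: polydisk_iff intro: le_less_trans)
  hence "continuous_on ?K f"
    using f by (auto simp: analytic0_def analytic_polydisk_def intro: continuous_on_subset)
  ultimately have "bounded (f ` ?K)"
    by (intro compact_imp_bounded compact_continuous_image)
  then obtain B where "\<And>z. z \<in> ?K \<Longrightarrow> cmod (f z) \<le> B"
    by (auto simp: bounded_iff)
  \<comment> \<open>For negative \<open>R\<close> the set \<open>?K\<close> is empty and
    \<open>B\<close> may be any number; the maximum secures a nonnegative bound.\<close>
  thus ?thesis by (intro that[of "max 0 B"]) (auto simp: le_max_iff_disj)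
qed

text \<open>Since \<open>f\<close> vanishes outside the polydisk, the one-variable Cauchy formula can be applied for every value
  of the remaining variables in the induction, not just for almost every one.\<close>

lemma polydisk_Cauchy_aux:
  fixes f :: "complex ^ 'n::finite \<Rightarrow> complex"
  assumes f: "analytic0 f" and R: "0 < R" "R < 1" and z: "\<And>i. cmod (z $ i) < R"
    and I: "finite I"
  shows "(\<integral>x. f (\<chi> i. if i \<in> I then complex_of_real R * x i else z $ i) *
      (\<Prod>i\<in>I. 1 / (1 - z $ i * cnj (x i) / R)) \<partial>PiM I (\<lambda>_. circle_measure)) = f z"
  using I
proof (induction I rule: finite_induct)
  case empty
  thus ?case by (simp add: PiM_empty lebesgue_integral_count_space_finite)
next
  case (insert j I)
  interpret product_sigma_finite "\<lambda>_::'n. circle_measure"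
    by (simp add: product_sigma_finite_def circle.sigma_finite_measure_axioms)
  interpret P: prob_space "PiM (insert j I) (\<lambda>_::'n. circle_measure)"
    by (intro prob_space_PiM prob_space_circle)
  note [measurable] = analytic0_borel[OF f]
  define G where "G = (\<lambda>J x. f (\<chi> i. if i \<in> J then complex_of_real R * x i else z $ i) *
      (\<Prod>i\<in>J. 1 / (1 - z $ i * cnj (x i) / R)))"
  have comp: "(\<lambda>x. x i) \<in> borel_measurable (PiM J (\<lambda>_::'n. circle_measure))" if "i \<in> J" for i J
  proof -
    have "(\<lambda>x. x i) \<in> measurable (PiM J (\<lambda>_::'n. circle_measure)) circle_measure"
      using that by measurable
    thus ?thesis by (simp add: circle_measure_def cong: measurable_cong_sets)
  qed
  have vmeas: "(\<lambda>x. \<chi> i. if i \<in> J then complex_of_real R * x i else z $ i)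
      \<in> borel_measurable (PiM J (\<lambda>_. circle_measure))" for J
  proof (rule borel_measurable_vec)
    fix i show "(\<lambda>x. if i \<in> J then complex_of_real R * x i else z $ i) \<in> borel_measurable (PiM J (\<lambda>_. circle_measure))"
      by (cases "i \<in> J") (auto intro!: borel_measurable_times comp)
  qed
  have Gmeas: "G J \<in> borel_measurable (PiM J (\<lambda>_. circle_measure))" for J
    unfolding G_def
    by (intro borel_measurable_times borel_measurable_prod borel_measurable_divide borel_measurable_diff
        measurable_compose[OF vmeas analytic0_borel[OF f]] measurable_compose[OF comp borel_cnj] borel_measurable_const)
  obtain B where B: "B \<ge> 0" "\<And>z. (\<And>i. cmod (z $ i) \<le> R) \<Longrightarrow> cmod (f z) \<le> B"
    using analytic0_bounded[OF f R(2)] by metis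
  let ?J = "insert j I"
  have zR: "cmod (z $ i) / R < 1" for i using z[of i] R by simp
  have "AE x in PiM ?J (\<lambda>_. circle_measure). \<forall>i\<in>?J. cmod (x i) = 1"
    by (intro AE_finite_allI AE_PiM_component AE_circle prob_space_circle) (use insert in auto)
  hence "AE x in PiM ?J (\<lambda>_. circle_measure). norm (G ?J x) \<le> B * (\<Prod>i\<in>?J. 1 / (1 - cmod (z $ i) / R))"
  proof eventually_elim
    case (elim x)
    have "cmod (f (\<chi> i. if i \<in> ?J then complex_of_real R * x i else z $ i)) \<le> B"
      using elim z R by (intro B(2)) (auto simp: norm_mult intro: less_imp_le)
    moreover have "cmod (\<Prod>i\<in>?J. 1 / (1 - z $ i * cnj (x i) / R)) \<le> (\<Prod>i\<in>?J. 1 / (1 - cmod (z $ i) / R))"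
      unfolding prod_norm[symmetric]
    proof (intro prod_mono conjI norm_ge_zero)
      fix i assume "i \<in> ?J"
      hence "cmod (x i) = 1" using elim by blast
      hence "cmod (z $ i * cnj (x i) / R) = cmod (z $ i) / R"
        using R by (simp add: norm_mult norm_divide)
      hence "1 - cmod (z $ i) / R \<le> cmod (1 - z $ i * cnj (x i) / R)"
        using norm_triangle_ineq2[of 1 "z $ i * cnj (x i) / R"] by simp
      thus "cmod (1 / (1 - z $ i * cnj (x i) / R)) \<le> 1 / (1 - cmod (z $ i) / R)"
        using zR[of i] by (simp add: norm_divide frac_le)
    qed
    ultimately show ?case unfolding G_def norm_mult using B(1) by (intro mult_mono) auto
  qed
  hence int: "integrable (PiM ?J (\<lambda>_. circle_measure)) (G ?J)"
    by (rule P.integrable_const_bound[OF _ Gmeas])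
  have inner: "(\<integral>y. G ?J (x(j := y)) \<partial>circle_measure) = G I x" for x
  proof -
    define p where "p = (\<chi> i. if i \<in> I then complex_of_real R * x i else z $ i)"
    define C where "C = (\<Prod>i\<in>I. 1 / (1 - z $ i * cnj (x i) / R))"
    have pj: "p $ j = z $ j" using insert by (simp add: p_def)
    have "(\<chi> i. if i \<in> ?J then complex_of_real R * (x(j := y)) i else z $ i) = upd p j (complex_of_real R * y)" for y
      by (auto simp: p_def vec_eq_iff)
    moreover have "(\<Prod>i\<in>?J. 1 / (1 - z $ i * cnj ((x(j := y)) i) / R)) = C / (1 - z $ j * cnj y / R)" for y
    proof -
      have "(\<Prod>i\<in>I. 1 / (1 - z $ i * cnj ((x(j := y)) i) / R)) = C"
        unfolding C_def using insert by (intro prod.cong) auto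
      thus ?thesis using insert by simp
    qed
    ultimately have G: "G ?J (x(j := y)) = f (upd p j (complex_of_real R * y)) * (C / (1 - z $ j * cnj y / R))" for y
      unfolding G_def by metis
    have G': "G I x = f p * C" by (simp add: G_def p_def C_def)
    show ?thesis
    proof (cases "p \<in> polydisk")
      case True
      have "(\<integral>y. f (upd p j (complex_of_real R * y)) / (1 - z $ j * cnj y / R) \<partial>circle_measure) = f (upd p j (z $ j))"
      proof (rule circle_Cauchy[where g = "\<lambda>w. f (upd p j w)"])
        show "(\<lambda>w. f (upd p j w)) holomorphic_on ball 0 1"
          using f True by (auto simp: analytic0_def analytic_polydisk_def)
        have "(\<lambda>w. upd p j w) \<in> borel_measurable borel"
          unfolding upd_def by (rule borel_measurable_vec) auto
        thus "(\<lambda>w. f (upd p j w)) \<in> borel_measurable borel" by measurable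
      qed (use R z in auto)
      also have "upd p j (z $ j) = p" using pj by (metis upd_same)
      finally have "C * (\<integral>y. f (upd p j (complex_of_real R * y)) / (1 - z $ j * cnj y / R) \<partial>circle_measure) = C * f p"
        by simp
      moreover have "(\<lambda>y. G ?J (x(j := y))) =
          (\<lambda>y. C * (f (upd p j (complex_of_real R * y)) / (1 - z $ j * cnj y / R)))"
        by (rule ext, subst G) (simp add: mult.commute)
      ultimately show ?thesis unfolding G' by (simp only: integral_mult_right_zero mult.commute)
    next
      case False
      then obtain i where i: "cmod (p $ i) \<ge> 1" by (auto simp: polydisk_iff not_less)
      \<comment> \<open>The coordinate \<open>j\<close> of \<open>p\<close> is still that of
        \<open>z\<close>, which is inside the disk. The offending coordinate is therefore another
        one, and varying coordinate \<open>j\<close> cannot bring the point back into the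
        polydisk.\<close>
      have "i \<noteq> j" using i pj z[of j] R by auto
      hence "upd p j w \<notin> polydisk" for w
        using i by (auto simp: polydisk_iff not_less intro!: exI[of _ i])
      hence "(\<lambda>y. G ?J (x(j := y))) = (\<lambda>y. 0)"
        using f by (intro ext) (simp only: G, simp add: analytic0_def)
      thus ?thesis unfolding G' using f False by (simp add: analytic0_def)
    qed
  qed
  have "integral\<^sup>L (PiM ?J (\<lambda>_. circle_measure)) (G ?J) = (\<integral>x. (\<integral>y. G ?J (x(j := y)) \<partial>circle_measure) \<partial>PiM I (\<lambda>_. circle_measure))"
    by (rule product_integral_insert) (use insert int in auto)
  also have "\<dots> = integral\<^sup>L (PiM I (\<lambda>_. circle_measure)) (G I)" by (simp only: inner)
  also have "\<dots> = f z" using insert.IH unfolding G_def .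
  finally show ?case unfolding G_def .
qed

lemma polydisk_Cauchy:
  fixes f :: "complex ^ 'n::finite \<Rightarrow> complex"
  assumes f: "analytic0 f" and R: "0 < R" "R < 1" and z: "\<And>i. cmod (z $ i) < R"
  shows "(\<integral>\<zeta>. f (R *\<^sub>R \<zeta>) * (\<Prod>i\<in>UNIV. 1 / (1 - z $ i * cnj (\<zeta> $ i) / R)) \<partial>torus_measure) = f z"
proof -
  note [measurable] = analytic0_borel[OF f]
  have "(\<lambda>\<zeta>. f (R *\<^sub>R \<zeta>) * (\<Prod>i\<in>UNIV. 1 / (1 - z $ i * cnj (\<zeta> $ i) / R))) \<in> borel_measurable borel"
    by measurable
  moreover have "(\<chi> i. complex_of_real R * x i) = R *\<^sub>R vec_lambda x" for x :: "'n \<Rightarrow> complex"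
    by (simp add: vec_eq_iff scaleR_conv_of_real[where 'a = complex])
  ultimately show ?thesis
    using polydisk_Cauchy_aux[OF assms finite[of UNIV]] by (subst integral_torus) simp_all
qed

section \<open>From the Cauchy integral to Taylor coefficients\<close>

lemma infsum_geometric:
  assumes "cmod x < 1"
  shows "(\<lambda>m. norm (x ^ m)) summable_on UNIV" "infsum (\<lambda>m. x ^ m) UNIV = 1 / (1 - x)"
proof -
  have "summable (\<lambda>m. norm (x ^ m))" using assms by (simp add: norm_power)
  moreover have "(\<lambda>m. x ^ m) sums (1 / (1 - x))" using assms by (rule geometric_sums)
  ultimately have *: "((\<lambda>m. x ^ m) has_sum 1 / (1 - x)) UNIV"
    by (rule norm_summable_imp_has_sum)
  thus "infsum (\<lambda>m. x ^ m) UNIV = 1 / (1 - x)" by (rule infsumI)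
  show "(\<lambda>m. norm (x ^ m)) summable_on UNIV"
    using * summable_on_iff_abs_summable_on_complex by (metis has_sum_imp_summable)
qed

text \<open>A Fourier coefficient on the torus of radius \<open>R\<close>, rescaled to become the
  Taylor coefficient.\<close>

definition coef_at :: "(complex ^ 'n::finite \<Rightarrow> complex) \<Rightarrow> real \<Rightarrow> ('n \<Rightarrow> nat) \<Rightarrow> complex" where
  "coef_at f R \<alpha> = (\<integral>\<zeta>. f (R *\<^sub>R \<zeta>) * cnj (mpow \<zeta> \<alpha>) \<partial>torus_measure) / of_real (R ^ sum \<alpha> UNIV)"

lemma torus_scaleR_le: "\<forall>i. cmod (\<zeta> $ i) = 1 \<Longrightarrow> 0 < R \<Longrightarrow> cmod ((R *\<^sub>R \<zeta>) $ i) \<le> R"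
  by simp

text \<open>Each factor of the Cauchy kernel is a geometric series whose ratio has modulus |z_i| / R
  < 1 on the torus. The product series is dominated there, so Cauchy's formula can be integrated
  term by term.\<close>

lemma coef_at_has_sum:
  fixes f :: "complex ^ 'n::finite \<Rightarrow> complex"
  assumes f: "analytic0 f" and R: "0 < R" "R < 1" and z: "\<And>i. cmod (z $ i) < R"
  shows "((\<lambda>\<alpha>. coef_at f R \<alpha> * mpow z \<alpha>) has_sum f z) UNIV"
proof -
  note [measurable] = analytic0_borel[OF f]
  obtain B where B: "B \<ge> 0" "\<And>z. (\<And>i. cmod (z $ i) \<le> R) \<Longrightarrow> cmod (f z) \<le> B"
    using analytic0_bounded[OF f R(2)] by metis
  have zR: "cmod (complex_of_real (cmod (z $ i) / R)) < 1" for i using z[of i] R by (simp add: norm_divide)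
  define F where "F = (\<lambda>\<alpha> \<zeta>. f (R *\<^sub>R \<zeta>) * (\<Prod>i\<in>UNIV. (z $ i * cnj (\<zeta> $ i) / R) ^ \<alpha> i))"
  have "((\<lambda>\<alpha>. integral\<^sup>L torus_measure (F \<alpha>)) has_sum
      (\<integral>\<zeta>. f (R *\<^sub>R \<zeta>) * (\<Prod>i\<in>UNIV. 1 / (1 - z $ i * cnj (\<zeta> $ i) / R)) \<partial>torus_measure)) UNIV"
  proof (rule torus.integral_has_sum)
    show "F \<alpha> \<in> borel_measurable torus_measure" for \<alpha> unfolding F_def by measurable
    show "(\<lambda>\<zeta>. f (R *\<^sub>R \<zeta>) * (\<Prod>i\<in>UNIV. 1 / (1 - z $ i * cnj (\<zeta> $ i) / R))) \<in> borel_measurable torus_measure"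
      by measurable
    show "AE \<zeta> in torus_measure. \<forall>\<alpha>. cmod (F \<alpha> \<zeta>) \<le> B * (\<Prod>i\<in>UNIV. (cmod (z $ i) / R) ^ \<alpha> i)"
      using AE_torus
    proof eventually_elim
      case (elim \<zeta>)
      have "cmod (\<Prod>i\<in>UNIV. (z $ i * cnj (\<zeta> $ i) / R) ^ \<alpha> i) = (\<Prod>i\<in>UNIV. (cmod (z $ i) / R) ^ \<alpha> i)" for \<alpha>
        unfolding prod_norm[symmetric] using elim R by (intro prod.cong) (auto simp: norm_power norm_mult norm_divide)
      moreover have "cmod (f (R *\<^sub>R \<zeta>)) \<le> B" using torus_scaleR_le[OF elim R(1)] by (rule B(2))
      moreover have "(\<Prod>i\<in>UNIV. (cmod (z $ i) / R) ^ \<alpha> i) \<ge> 0" for \<alpha> :: "'n \<Rightarrow> nat" using R by (intro prod_nonneg) auto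
      ultimately show ?case unfolding F_def norm_mult by (auto intro: mult_right_mono)
    qed
    \<comment> \<open>The real dominating series is summed through complex factors, the form in
      which \<open>has_sum_prod_UNIV\<close> speaks.\<close>
    have "(\<lambda>\<alpha>. norm (\<Prod>i\<in>UNIV. complex_of_real (cmod (z $ i) / R) ^ \<alpha> i)) summable_on UNIV"
      by (rule has_sum_prod_UNIV(1)[where f = "\<lambda>i m. complex_of_real (cmod (z $ i) / R) ^ m"] infsum_geometric zR)+
    hence "(\<lambda>\<alpha>::'n \<Rightarrow> nat. \<Prod>i\<in>UNIV. (cmod (z $ i) / R) ^ \<alpha> i) summable_on UNIV"
      using R by (simp add: norm_power norm_divide flip: prod_norm)
    thus "(\<lambda>\<alpha>::'n \<Rightarrow> nat. B * (\<Prod>i\<in>UNIV. (cmod (z $ i) / R) ^ \<alpha> i)) summable_on UNIV"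
      by (rule summable_on_cmult_right)
    show "AE \<zeta> in torus_measure. ((\<lambda>\<alpha>. F \<alpha> \<zeta>) has_sum
        f (R *\<^sub>R \<zeta>) * (\<Prod>i\<in>UNIV. 1 / (1 - z $ i * cnj (\<zeta> $ i) / R))) UNIV"
      using AE_torus
    proof eventually_elim
      case (elim \<zeta>)
      have "cmod (z $ i * cnj (\<zeta> $ i) / R) < 1" for i
        using elim R z[of i] by (simp add: norm_mult norm_divide)
      hence "((\<lambda>\<alpha>. \<Prod>i\<in>UNIV. (z $ i * cnj (\<zeta> $ i) / R) ^ \<alpha> i) has_sum
          (\<Prod>i\<in>UNIV. infsum (\<lambda>m. (z $ i * cnj (\<zeta> $ i) / R) ^ m) UNIV)) UNIV"
        by (intro has_sum_prod_UNIV(2)[where f = "\<lambda>i m. (z $ i * cnj (\<zeta> $ i) / R) ^ m"] infsum_geometric) auto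
      thus ?case unfolding F_def
        using infsum_geometric(2)[OF \<open>\<And>i. cmod (z $ i * cnj (\<zeta> $ i) / R) < 1\<close>] by (intro has_sum_cmult_right) simp
    qed
  qed
  also have "(\<integral>\<zeta>. f (R *\<^sub>R \<zeta>) * (\<Prod>i\<in>UNIV. 1 / (1 - z $ i * cnj (\<zeta> $ i) / R)) \<partial>torus_measure) = f z"
    by (rule polydisk_Cauchy[OF assms])
  also have "(\<lambda>\<alpha>. integral\<^sup>L torus_measure (F \<alpha>)) = (\<lambda>\<alpha>. coef_at f R \<alpha> * mpow z \<alpha>)"
  proof
    fix \<alpha> :: "'n \<Rightarrow> nat"
    have "F \<alpha> = (\<lambda>\<zeta>. mpow z \<alpha> / of_real (R ^ sum \<alpha> UNIV) * (f (R *\<^sub>R \<zeta>) * cnj (mpow \<zeta> \<alpha>)))"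
      unfolding F_def mpow_def
      by (simp add: fun_eq_iff power_divide power_mult_distrib prod_dividef prod.distrib power_sum)
    thus "integral\<^sup>L torus_measure (F \<alpha>) = coef_at f R \<alpha> * mpow z \<alpha>"
      by (simp add: coef_at_def)
  qed
  finally show ?thesis .
qed

text \<open>Orthogonality of the monomials isolates one coefficient of any expansion. As the
  expansion holds beyond radius \<open>R\<close>, it converges absolutely at the point with all
  coordinates \<open>R\<close>, and this supplies the dominating series for termwise
  integration.\<close>

lemma coef_at_unique:
  fixes f :: "complex ^ 'n::finite \<Rightarrow> complex"
  assumes [measurable]: "f \<in> borel_measurable borel" and R: "0 < R" "R < S"
    and b: "\<And>z. (\<And>i. cmod (z $ i) < S) \<Longrightarrow> ((\<lambda>\<alpha>. b \<alpha> * mpow z \<alpha>) has_sum f z) UNIV"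
  shows "coef_at f R = b"
proof
  fix \<alpha> :: "'n \<Rightarrow> nat"
  define F where "F = (\<lambda>\<beta> \<zeta>. b \<beta> * mpow (R *\<^sub>R \<zeta>) \<beta> * cnj (mpow \<zeta> \<alpha>))"
  have "((\<lambda>\<beta>. integral\<^sup>L torus_measure (F \<beta>)) has_sum (\<integral>\<zeta>. f (R *\<^sub>R \<zeta>) * cnj (mpow \<zeta> \<alpha>) \<partial>torus_measure)) UNIV"
  proof (rule torus.integral_has_sum)
    show "F \<beta> \<in> borel_measurable torus_measure" for \<beta> unfolding F_def by measurable
    show "(\<lambda>\<zeta>. f (R *\<^sub>R \<zeta>) * cnj (mpow \<zeta> \<alpha>)) \<in> borel_measurable torus_measure" by measurable
    show "AE \<zeta> in torus_measure. \<forall>\<beta>. cmod (F \<beta> \<zeta>) \<le> cmod (b \<beta>) * R ^ sum \<beta> UNIV"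
      using AE_torus
      by eventually_elim (use R in \<open>simp add: F_def norm_mult mpow_scaleR norm_mpow_torus norm_power\<close>)
    have "((\<lambda>\<beta>. b \<beta> * mpow (\<chi> i. of_real R) \<beta>) has_sum f (\<chi> i. of_real R)) UNIV"
      using R by (intro b) auto
    hence "(\<lambda>\<beta>. norm (b \<beta> * mpow (\<chi> i. of_real R) \<beta>)) summable_on UNIV"
      by (metis has_sum_imp_summable summable_on_iff_abs_summable_on_complex)
    thus "(\<lambda>\<beta>. cmod (b \<beta>) * R ^ sum \<beta> UNIV) summable_on UNIV"
      using R by (simp add: norm_mult norm_mpow power_sum)
    show "AE \<zeta> in torus_measure. ((\<lambda>\<beta>. F \<beta> \<zeta>) has_sum f (R *\<^sub>R \<zeta>) * cnj (mpow \<zeta> \<alpha>)) UNIV"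
      using AE_torus
    proof eventually_elim
      case (elim \<zeta>)
      show ?case unfolding F_def
        by (intro has_sum_cmult_left b) (use elim R in simp)
    qed
  qed
  also have "(\<lambda>\<beta>. integral\<^sup>L torus_measure (F \<beta>)) = (\<lambda>\<beta>. if \<beta> = \<alpha> then b \<alpha> * of_real (R ^ sum \<alpha> UNIV) else 0)"
  proof
    fix \<beta> :: "'n \<Rightarrow> nat"
    have "F \<beta> = (\<lambda>\<zeta>. b \<beta> * of_real (R ^ sum \<beta> UNIV) * (mpow \<zeta> \<beta> * cnj (mpow \<zeta> \<alpha>)))"
      by (simp add: F_def mpow_scaleR fun_eq_iff)
    thus "integral\<^sup>L torus_measure (F \<beta>) = (if \<beta> = \<alpha> then b \<alpha> * of_real (R ^ sum \<alpha> UNIV) else 0)"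
      by (simp only: integral_mult_right_zero torus_integral_monomial) simp
  qed
  finally have "((\<lambda>\<beta>. if \<beta> = \<alpha> then b \<alpha> * of_real (R ^ sum \<alpha> UNIV) else 0) has_sum
      (\<integral>\<zeta>. f (R *\<^sub>R \<zeta>) * cnj (mpow \<zeta> \<alpha>) \<partial>torus_measure)) UNIV" .
  moreover have "((\<lambda>\<beta>. if \<beta> = \<alpha> then b \<alpha> * of_real (R ^ sum \<alpha> UNIV) else 0) has_sum
      b \<alpha> * of_real (R ^ sum \<alpha> UNIV)) UNIV"
    by (rule has_sum_finite_neutralI[of "{\<alpha>}"]) auto
  ultimately have "(\<integral>\<zeta>. f (R *\<^sub>R \<zeta>) * cnj (mpow \<zeta> \<alpha>) \<partial>torus_measure) = b \<alpha> * of_real (R ^ sum \<alpha> UNIV)"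
    by (rule has_sum_unique)
  thus "coef_at f R \<alpha> = b \<alpha>" using R by (simp add: coef_at_def)
qed

text \<open>The radius is immaterial for functions analytic on the polydisk, see \<open>coef_at_eq_hcoef\<close> below.\<close>

definition hcoef :: "(complex ^ 'n::finite \<Rightarrow> complex) \<Rightarrow> ('n \<Rightarrow> nat) \<Rightarrow> complex" where
  "hcoef f = coef_at f (1 / 2)"

text \<open>The standard way to compute coefficients below: sums, multiples, conjugates, kernels and
  monomials all get theirs from an explicit expansion.\<close>

lemma hcoef_unique:
  assumes "f \<in> borel_measurable borel"
    and "\<And>z. z \<in> polydisk \<Longrightarrow> ((\<lambda>\<alpha>. b \<alpha> * mpow z \<alpha>) has_sum f z) UNIV"
  shows "hcoef f = b"
  unfolding hcoef_def by (rule coef_at_unique[where S = 1]) (use assms in \<open>auto simp: polydisk_iff\<close>)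

text \<open>Both radii are compared with a larger one: the expansion with coefficients taken at
  \<open>S\<close> is valid on the polydisk of radius \<open>S\<close>, so uniqueness applies to it
  at \<open>R\<close> and at 1/2.\<close>

lemma coef_at_eq_hcoef:
  assumes "analytic0 f" "0 < R" "R < 1"
  shows "coef_at f R = hcoef f"
proof -
  define S where "S = (1 + max R (1/2)) / 2"
  have S: "R < S" "1/2 < S" "S < 1" using assms by (auto simp: S_def max_def)
  have *: "((\<lambda>\<alpha>. coef_at f S \<alpha> * mpow z \<alpha>) has_sum f z) UNIV" if "\<And>i. cmod (z $ i) < S" for z
    using assms S that by (intro coef_at_has_sum) auto
  have "coef_at f R = coef_at f S" "coef_at f (1/2) = coef_at f S"
    using assms S * by (auto intro!: coef_at_unique[where S = S] analytic0_borel)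
  thus ?thesis by (simp add: hcoef_def)
qed

lemma hcoef_has_sum:
  fixes f :: "complex ^ 'n::finite \<Rightarrow> complex"
  assumes f: "analytic0 f" and z: "z \<in> polydisk"
  shows "((\<lambda>\<alpha>. hcoef f \<alpha> * mpow z \<alpha>) has_sum f z) UNIV"
proof -
  define m where "m = Max (range (\<lambda>i. cmod (z $ i)))"
  have m: "cmod (z $ i) \<le> m" for i by (auto simp: m_def)
  have "m < 1" using z by (simp add: m_def polydisk_iff)
  moreover have "0 \<le> m" using m[of undefined] norm_ge_zero order_trans by blast
  \<comment> \<open>Any radius strictly between the largest |z_i| and 1 serves; the midpoint is
    taken.\<close>
  ultimately have R: "m < (1 + m) / 2" "0 < (1 + m) / 2" "(1 + m) / 2 < 1" by auto
  have "((\<lambda>\<alpha>. coef_at f ((1 + m) / 2) \<alpha> * mpow z \<alpha>) has_sum f z) UNIV"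
    by (rule coef_at_has_sum[OF f R(2,3)]) (use m R in \<open>blast intro: le_less_trans\<close>)
  thus ?thesis using coef_at_eq_hcoef[OF f R(2,3)] by simp
qed

lemma hcoef_summable:
  assumes f: "analytic0 f" and R: "0 < R" "R < 1"
  shows "(\<lambda>\<alpha>. cmod (hcoef f \<alpha>) * R ^ sum \<alpha> UNIV) summable_on UNIV"
proof -
  have "((\<lambda>\<beta>. hcoef f \<beta> * mpow (\<chi> i. of_real R) \<beta>) has_sum f (\<chi> i. of_real R)) UNIV"
    using R by (intro hcoef_has_sum f) (auto simp: polydisk_iff)
  hence "(\<lambda>\<beta>. norm (hcoef f \<beta> * mpow (\<chi> i. of_real R) \<beta>)) summable_on UNIV"
    by (metis has_sum_imp_summable summable_on_iff_abs_summable_on_complex)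
  thus ?thesis using R by (simp add: norm_mult norm_mpow power_sum)
qed

section \<open>The Hardy space as a space of square summable coefficients\<close>

text \<open>Only one factor of |f|^2 = f cnj(f) is expanded. Integrating its terms against the other
  factor gives, by the definition of \<open>coef_at\<close>, conjugates of coefficients, so a single
  series suffices.\<close>

lemma parseval:
  fixes f :: "complex ^ 'n::finite \<Rightarrow> complex"
  assumes f: "analytic0 f" and r: "0 < r" "r < 1"
  shows "((\<lambda>\<alpha>. (cmod (hcoef f \<alpha>))\<^sup>2 * (r ^ sum \<alpha> UNIV)\<^sup>2) has_sum
      (\<integral>\<zeta>. (cmod (f (r *\<^sub>R \<zeta>)))\<^sup>2 \<partial>torus_measure)) UNIV"
proof -
  note [measurable] = analytic0_borel[OF f]
  obtain B where B: "B \<ge> 0" "\<And>z. (\<And>i. cmod (z $ i) \<le> r) \<Longrightarrow> cmod (f z) \<le> B"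
    using analytic0_bounded[OF f r(2)] by metis
  define F where "F = (\<lambda>\<alpha> \<zeta>. hcoef f \<alpha> * mpow (r *\<^sub>R \<zeta>) \<alpha> * cnj (f (r *\<^sub>R \<zeta>)))"
  have "((\<lambda>\<alpha>. integral\<^sup>L torus_measure (F \<alpha>)) has_sum (\<integral>\<zeta>. f (r *\<^sub>R \<zeta>) * cnj (f (r *\<^sub>R \<zeta>)) \<partial>torus_measure)) UNIV"
  proof (rule torus.integral_has_sum)
    show "F \<alpha> \<in> borel_measurable torus_measure" for \<alpha> unfolding F_def by measurable
    show "(\<lambda>\<zeta>. f (r *\<^sub>R \<zeta>) * cnj (f (r *\<^sub>R \<zeta>))) \<in> borel_measurable torus_measure" by measurable
    show "AE \<zeta> in torus_measure. \<forall>\<alpha>. cmod (F \<alpha> \<zeta>) \<le> B * (cmod (hcoef f \<alpha>) * r ^ sum \<alpha> UNIV)"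
      using AE_torus
    proof eventually_elim
      case (elim \<zeta>)
      have "cmod (f (r *\<^sub>R \<zeta>)) \<le> B" using torus_scaleR_le[OF elim r(1)] by (rule B(2))
      hence "cmod (hcoef f \<alpha>) * r ^ sum \<alpha> UNIV * cmod (f (r *\<^sub>R \<zeta>)) \<le> cmod (hcoef f \<alpha>) * r ^ sum \<alpha> UNIV * B" for \<alpha>
        using r by (intro mult_left_mono) auto
      thus ?case using r elim by (simp add: F_def norm_mult mpow_scaleR norm_mpow_torus norm_power mult_ac)
    qed
    show "(\<lambda>\<alpha>. B * (cmod (hcoef f \<alpha>) * r ^ sum \<alpha> UNIV)) summable_on UNIV"
      by (intro summable_on_cmult_right hcoef_summable f r)
    show "AE \<zeta> in torus_measure. ((\<lambda>\<alpha>. F \<alpha> \<zeta>) has_sum f (r *\<^sub>R \<zeta>) * cnj (f (r *\<^sub>R \<zeta>))) UNIV"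
      using AE_torus
    proof eventually_elim
      case (elim \<zeta>)
      have "r *\<^sub>R \<zeta> \<in> polydisk" using elim r by (simp add: polydisk_iff)
      thus ?case unfolding F_def by (intro has_sum_cmult_left hcoef_has_sum f)
    qed
  qed
  also have "(\<lambda>\<alpha>. integral\<^sup>L torus_measure (F \<alpha>)) =
      (\<lambda>\<alpha>. of_real ((cmod (hcoef f \<alpha>))\<^sup>2 * (r ^ sum \<alpha> UNIV)\<^sup>2))"
  proof
    fix \<alpha> :: "'n \<Rightarrow> nat"
    have "F \<alpha> = (\<lambda>\<zeta>. hcoef f \<alpha> * of_real (r ^ sum \<alpha> UNIV) * cnj (f (r *\<^sub>R \<zeta>) * cnj (mpow \<zeta> \<alpha>)))"
      by (simp add: F_def mpow_scaleR fun_eq_iff)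
    hence "integral\<^sup>L torus_measure (F \<alpha>) = hcoef f \<alpha> * of_real (r ^ sum \<alpha> UNIV) *
        cnj (\<integral>\<zeta>. f (r *\<^sub>R \<zeta>) * cnj (mpow \<zeta> \<alpha>) \<partial>torus_measure)"
      by (simp only: integral_mult_right_zero Bochner_Integration.integral_cnj)
    also have "(\<integral>\<zeta>. f (r *\<^sub>R \<zeta>) * cnj (mpow \<zeta> \<alpha>) \<partial>torus_measure) = hcoef f \<alpha> * of_real (r ^ sum \<alpha> UNIV)"
      using coef_at_eq_hcoef[OF f r] r by (simp add: coef_at_def fun_eq_iff field_simps)
    also have "hcoef f \<alpha> * of_real (r ^ sum \<alpha> UNIV) * cnj (hcoef f \<alpha> * of_real (r ^ sum \<alpha> UNIV)) =
        of_real ((cmod (hcoef f \<alpha> * of_real (r ^ sum \<alpha> UNIV)))\<^sup>2)"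
      by (rule complex_norm_square[symmetric])
    also have "(cmod (hcoef f \<alpha> * of_real (r ^ sum \<alpha> UNIV)))\<^sup>2 = (cmod (hcoef f \<alpha>))\<^sup>2 * (r ^ sum \<alpha> UNIV)\<^sup>2"
      using r by (simp add: norm_mult norm_power power_mult_distrib)
    finally show "integral\<^sup>L torus_measure (F \<alpha>) = of_real ((cmod (hcoef f \<alpha>))\<^sup>2 * (r ^ sum \<alpha> UNIV)\<^sup>2)" .
  qed
  also have "(\<integral>\<zeta>. f (r *\<^sub>R \<zeta>) * cnj (f (r *\<^sub>R \<zeta>)) \<partial>torus_measure) =
      of_real (\<integral>\<zeta>. (cmod (f (r *\<^sub>R \<zeta>)))\<^sup>2 \<partial>torus_measure)"
    by (simp only: complex_norm_square[symmetric] integral_complex_of_real)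
  finally show ?thesis by (simp only: has_sum_of_real_iff)
qed

lemma nn_integral_parseval:
  fixes f :: "complex ^ 'n::finite \<Rightarrow> complex"
  assumes f: "analytic0 f" and r: "0 < r" "r < 1"
  shows "(\<integral>\<^sup>+ \<zeta>. ennreal ((cmod (f (r *\<^sub>R \<zeta>)))\<^sup>2) \<partial>torus_measure) =
    ennreal (infsum (\<lambda>\<alpha>. (cmod (hcoef f \<alpha>))\<^sup>2 * (r ^ sum \<alpha> UNIV)\<^sup>2) UNIV)"
proof -
  note [measurable] = analytic0_borel[OF f]
  obtain B where B: "B \<ge> 0" "\<And>z. (\<And>i. cmod (z $ i) \<le> r) \<Longrightarrow> cmod (f z) \<le> B"
    using analytic0_bounded[OF f r(2)] by metis
  have "integrable torus_measure (\<lambda>\<zeta>. (cmod (f (r *\<^sub>R \<zeta>)))\<^sup>2)"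
  proof (rule torus.integrable_const_bound)
    show "AE \<zeta> in torus_measure. norm ((cmod (f (r *\<^sub>R \<zeta>)))\<^sup>2) \<le> B\<^sup>2"
      using AE_torus
    proof eventually_elim
      case (elim \<zeta>)
      have "cmod (f (r *\<^sub>R \<zeta>)) \<le> B" using torus_scaleR_le[OF elim r(1)] by (rule B(2))
      thus ?case by (simp add: power_mono)
    qed
    show "(\<lambda>\<zeta>. (cmod (f (r *\<^sub>R \<zeta>)))\<^sup>2) \<in> borel_measurable torus_measure" by measurable
  qed
  thus ?thesis
    by (subst nn_integral_eq_integral) (simp_all add: infsumI[OF parseval[OF assms]])
qed

text \<open>The limit r -> 1 is taken inside finite partial sums, where it is immediate. Each of
  them is bounded by the squared norm for every r, and such uniform bounds give both summability and
  the estimate of the sum.\<close>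

lemma
  fixes f :: "complex ^ 'n::finite \<Rightarrow> complex"
  assumes f: "analytic0 f" and fin: "hardy_norm_sq f < \<infinity>"
  shows hardy_summable: "(\<lambda>\<alpha>. (cmod (hcoef f \<alpha>))\<^sup>2) summable_on UNIV"
    and hardy_infsum_le: "infsum (\<lambda>\<alpha>. (cmod (hcoef f \<alpha>))\<^sup>2) UNIV \<le> enn2real (hardy_norm_sq f)"
proof -
  let ?K = "enn2real (hardy_norm_sq f)"
  have le: "sum (\<lambda>\<alpha>. (cmod (hcoef f \<alpha>))\<^sup>2) X \<le> ?K" if X: "finite X" for X
  proof (rule tendsto_upperbound)
    have "((\<lambda>r::real. \<Sum>\<alpha>\<in>X. (cmod (hcoef f \<alpha>))\<^sup>2 * (r ^ sum \<alpha> UNIV)\<^sup>2) \<longlongrightarrow>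
        (\<Sum>\<alpha>\<in>X. (cmod (hcoef f \<alpha>))\<^sup>2 * (1 ^ sum \<alpha> UNIV)\<^sup>2)) (at_left 1)"
      by (intro tendsto_intros)
    thus "((\<lambda>r::real. \<Sum>\<alpha>\<in>X. (cmod (hcoef f \<alpha>))\<^sup>2 * (r ^ sum \<alpha> UNIV)\<^sup>2) \<longlongrightarrow>
        (\<Sum>\<alpha>\<in>X. (cmod (hcoef f \<alpha>))\<^sup>2)) (at_left 1)"
      by simp
    have "(\<Sum>\<alpha>\<in>X. (cmod (hcoef f \<alpha>))\<^sup>2 * (r ^ sum \<alpha> UNIV)\<^sup>2) \<le> ?K" if r: "r \<in> {0<..<1}" for r :: real
    proof -
      let ?S = "infsum (\<lambda>\<alpha>. (cmod (hcoef f \<alpha>))\<^sup>2 * (r ^ sum \<alpha> UNIV)\<^sup>2) UNIV"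
      have le: "(\<Sum>\<alpha>\<in>X. (cmod (hcoef f \<alpha>))\<^sup>2 * (r ^ sum \<alpha> UNIV)\<^sup>2) \<le> ?S"
        using r X by (intro finite_sum_le_infsum has_sum_imp_summable[OF parseval] f) auto
      have "ennreal ?S \<le> hardy_norm_sq f"
        unfolding hardy_norm_sq_def using r by (subst nn_integral_parseval[symmetric, OF f]) (auto intro: SUP_upper)
      also have "hardy_norm_sq f = ennreal ?K" using fin by simp
      finally have "?S \<le> ?K" by (simp add: ennreal_le_iff)
      with le show ?thesis by (rule order_trans)
    qed
    thus "\<forall>\<^sub>F r in at_left 1. (\<Sum>\<alpha>\<in>X. (cmod (hcoef f \<alpha>))\<^sup>2 * (r ^ sum \<alpha> UNIV)\<^sup>2) \<le> ?K"
      by (intro eventually_mono[OF eventually_at_left_real[of 0 1]]) auto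
  qed simp
  show *: "(\<lambda>\<alpha>. (cmod (hcoef f \<alpha>))\<^sup>2) summable_on UNIV"
    by (rule nonneg_bdd_above_summable_on) (auto intro!: bdd_aboveI le)
  show "infsum (\<lambda>\<alpha>. (cmod (hcoef f \<alpha>))\<^sup>2) UNIV \<le> ?K"
    by (rule infsum_le_finite_sums[OF *]) (use le in auto)
qed

text \<open>The weights (r^|\<alpha>|)^2 are at most 1, so by Parseval the full sum dominates the
  mean square on every radius.\<close>

lemma hardy_norm_sq_le:
  fixes f :: "complex ^ 'n::finite \<Rightarrow> complex"
  assumes f: "analytic0 f" and S: "(\<lambda>\<alpha>. (cmod (hcoef f \<alpha>))\<^sup>2) summable_on UNIV"
  shows "hardy_norm_sq f \<le> ennreal (infsum (\<lambda>\<alpha>. (cmod (hcoef f \<alpha>))\<^sup>2) UNIV)"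
  unfolding hardy_norm_sq_def
proof (rule SUP_least)
  fix r :: real assume r: "r \<in> {0<..<1}"
  have "(r ^ n)\<^sup>2 \<le> 1" for n using r by (simp add: power_le_one)
  hence "infsum (\<lambda>\<alpha>. (cmod (hcoef f \<alpha>))\<^sup>2 * (r ^ sum \<alpha> UNIV)\<^sup>2) UNIV \<le> infsum (\<lambda>\<alpha>. (cmod (hcoef f \<alpha>))\<^sup>2) UNIV"
    using r by (intro infsum_mono S has_sum_imp_summable[OF parseval] f mult_left_le) auto
  thus "(\<integral>\<^sup>+ \<zeta>. ennreal ((cmod (f (r *\<^sub>R \<zeta>)))\<^sup>2) \<partial>torus_measure) \<le> ennreal (infsum (\<lambda>\<alpha>. (cmod (hcoef f \<alpha>))\<^sup>2) UNIV)"
    using r by (subst nn_integral_parseval[OF f]) (auto intro: ennreal_leI)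
qed

lemma hardy_space_iff:
  "f \<in> hardy_space \<longleftrightarrow> analytic0 f \<and> (\<lambda>\<alpha>. (cmod (hcoef f \<alpha>))\<^sup>2) summable_on UNIV"
proof
  assume "f \<in> hardy_space"
  hence "analytic0 f" "hardy_norm_sq f < \<infinity>" by (simp_all add: hardy_space_def analytic0_def)
  thus "analytic0 f \<and> (\<lambda>\<alpha>. (cmod (hcoef f \<alpha>))\<^sup>2) summable_on UNIV" using hardy_summable by blast
next
  assume *: "analytic0 f \<and> (\<lambda>\<alpha>. (cmod (hcoef f \<alpha>))\<^sup>2) summable_on UNIV"
  hence "hardy_norm_sq f < \<infinity>"
    using hardy_norm_sq_le[of f] by (metis ennreal_less_top infinity_ennreal_def le_less_trans)
  with * show "f \<in> hardy_space" by (simp add: hardy_space_def analytic0_def)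
qed

lemma
  assumes "f \<in> hardy_space"
  shows hardy_norm_power2: "(hardy_norm f)\<^sup>2 = infsum (\<lambda>\<alpha>. (cmod (hcoef f \<alpha>))\<^sup>2) UNIV"
    and hardy_has_sum: "((\<lambda>\<alpha>. (cmod (hcoef f \<alpha>))\<^sup>2) has_sum (hardy_norm f)\<^sup>2) UNIV"
proof -
  let ?S = "infsum (\<lambda>\<alpha>. (cmod (hcoef f \<alpha>))\<^sup>2) UNIV"
  have f: "analytic0 f" "(\<lambda>\<alpha>. (cmod (hcoef f \<alpha>))\<^sup>2) summable_on UNIV" and fin: "hardy_norm_sq f < \<infinity>"
    using assms hardy_space_iff[of f] by (auto simp: hardy_space_def)
  have S0: "?S \<ge> 0" by (intro infsum_nonneg) auto
  hence "enn2real (hardy_norm_sq f) = ?S"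
    using enn2real_mono[OF hardy_norm_sq_le[OF f]] hardy_infsum_le[OF f(1) fin] by simp
  thus *: "(hardy_norm f)\<^sup>2 = ?S" using S0 by (simp add: hardy_norm_def)
  show "((\<lambda>\<alpha>. (cmod (hcoef f \<alpha>))\<^sup>2) has_sum (hardy_norm f)\<^sup>2) UNIV"
    unfolding * by (rule has_sum_infsum[OF f(2)])
qed

section \<open>Linear structure and inner product in terms of coefficients\<close>

lemma hardy_norm_nonneg: "hardy_norm f \<ge> 0"
  by (simp add: hardy_norm_def)

lemma analytic0_add: "analytic0 f \<Longrightarrow> analytic0 g \<Longrightarrow> analytic0 (\<lambda>z. f z + g z)"
  by (auto simp: analytic0_def analytic_polydisk_def intro!: continuous_intros holomorphic_intros)

lemma analytic0_cmult: "analytic0 f \<Longrightarrow> analytic0 (\<lambda>z. c * f z)"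
  by (auto simp: analytic0_def analytic_polydisk_def intro!: continuous_intros holomorphic_intros)

lemma hcoef_add:
  assumes "analytic0 f" "analytic0 g"
  shows "hcoef (\<lambda>z. f z + g z) = (\<lambda>\<alpha>. hcoef f \<alpha> + hcoef g \<alpha>)"
  by (rule hcoef_unique)
     (use assms in \<open>auto intro!: analytic0_borel analytic0_add has_sum_add hcoef_has_sum simp: distrib_right\<close>)

lemma hcoef_cmult:
  assumes "analytic0 f"
  shows "hcoef (\<lambda>z. c * f z) = (\<lambda>\<alpha>. c * hcoef f \<alpha>)"
  by (rule hcoef_unique)
     (use assms in \<open>auto intro!: analytic0_borel analytic0_cmult has_sum_cmult_right hcoef_has_sum simp: mult.assoc\<close>)

lemma hardy_space_cmult: "f \<in> hardy_space \<Longrightarrow> (\<lambda>z. c * f z) \<in> hardy_space"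
  by (auto simp: hardy_space_iff analytic0_cmult hcoef_cmult norm_mult power_mult_distrib intro!: summable_on_cmult_right)

lemma hardy_space_add:
  assumes f: "f \<in> hardy_space" and g: "g \<in> hardy_space"
  shows "(\<lambda>z. f z + g z) \<in> hardy_space"
proof -
  have "(\<lambda>\<alpha>. (cmod (hcoef f \<alpha> + hcoef g \<alpha>))\<^sup>2) summable_on UNIV"
  proof (rule summable_on_comparison_test)
    show "(\<lambda>\<alpha>. 2 * (cmod (hcoef f \<alpha>))\<^sup>2 + 2 * (cmod (hcoef g \<alpha>))\<^sup>2) summable_on UNIV"
      using f g by (intro summable_on_add summable_on_cmult_right) (auto simp: hardy_space_iff)
    fix \<alpha>
    have "(cmod (hcoef f \<alpha> + hcoef g \<alpha>))\<^sup>2 \<le> (cmod (hcoef f \<alpha>) + cmod (hcoef g \<alpha>))\<^sup>2"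
      by (intro power_mono norm_triangle_ineq) auto
    also have "\<dots> \<le> 2 * (cmod (hcoef f \<alpha>))\<^sup>2 + 2 * (cmod (hcoef g \<alpha>))\<^sup>2"
      using sum_squares_bound[of "cmod (hcoef f \<alpha>)" "cmod (hcoef g \<alpha>)"] by (simp add: power2_sum)
    finally show "(cmod (hcoef f \<alpha> + hcoef g \<alpha>))\<^sup>2 \<le> 2 * (cmod (hcoef f \<alpha>))\<^sup>2 + 2 * (cmod (hcoef g \<alpha>))\<^sup>2" .
  qed auto
  thus ?thesis using f g by (auto simp: hardy_space_iff analytic0_add hcoef_add)
qed

lemma sum_lessThan_4: "(\<Sum>l<4. P l) = P 0 + P 1 + P 2 + P 3" for P :: "nat \<Rightarrow> complex"
  by (simp add: eval_nat_numeral)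

lemma polarization: "(\<Sum>l<4. \<i> ^ l * complex_of_real ((cmod (a + \<i> ^ l * b))\<^sup>2)) / 4 = a * cnj b"
  unfolding sum_lessThan_4 complex_norm_square by (simp add: power3_eq_cube algebra_simps)

text \<open>The inner product combines four squared norms, and each of these is a sum over
  coefficients. The scalar identity \<open>polarization\<close>, applied to every pair of
  coefficients, turns the combination into the pairing of square summable families, from which
  conjugate symmetry and linearity are then read off.\<close>

lemma hardy_inner_has_sum:
  assumes f: "f \<in> hardy_space" and g: "g \<in> hardy_space"
  shows "((\<lambda>\<alpha>. hcoef f \<alpha> * cnj (hcoef g \<alpha>)) has_sum hardy_inner f g) UNIV"
proof -
  have a: "analytic0 f" "analytic0 g" using f g by (auto simp: hardy_space_iff)
  have "((\<lambda>\<alpha>. (cmod (hcoef f \<alpha> + \<i> ^ l * hcoef g \<alpha>))\<^sup>2) has_sum (hardy_norm (\<lambda>z. f z + \<i> ^ l * g z))\<^sup>2) UNIV" for l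
    using hardy_has_sum[OF hardy_space_add[OF f hardy_space_cmult[OF g]]]
    by (simp add: hcoef_add[OF a(1) analytic0_cmult[OF a(2)]] hcoef_cmult[OF a(2)])
  hence "((\<lambda>\<alpha>. (1/4) * (\<Sum>l<4. \<i> ^ l * complex_of_real ((cmod (hcoef f \<alpha> + \<i> ^ l * hcoef g \<alpha>))\<^sup>2))) has_sum
      (1/4) * (\<Sum>l<4. \<i> ^ l * complex_of_real ((hardy_norm (\<lambda>z. f z + \<i> ^ l * g z))\<^sup>2))) UNIV"
    unfolding sum_lessThan_4 by (intro has_sum_cmult_right has_sum_add has_sum_of_real)
  thus ?thesis using polarization by (simp add: hardy_inner_def)
qed

lemma hardy_inner_cnj:
  assumes "f \<in> hardy_space" "g \<in> hardy_space"
  shows "hardy_inner g f = cnj (hardy_inner f g)"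
proof -
  have "((\<lambda>\<alpha>. cnj (hcoef f \<alpha> * cnj (hcoef g \<alpha>))) has_sum cnj (hardy_inner f g)) UNIV"
    by (subst has_sum_cnj_iff) (rule hardy_inner_has_sum[OF assms])
  thus ?thesis using has_sum_unique hardy_inner_has_sum[OF assms(2,1)] by (fastforce simp: mult.commute)
qed

lemma hardy_inner_add_left:
  assumes "f \<in> hardy_space" "g \<in> hardy_space" "h \<in> hardy_space"
  shows "hardy_inner (\<lambda>z. f z + g z) h = hardy_inner f h + hardy_inner g h"
proof (rule has_sum_unique)
  show "((\<lambda>\<alpha>. hcoef (\<lambda>z. f z + g z) \<alpha> * cnj (hcoef h \<alpha>)) has_sum hardy_inner (\<lambda>z. f z + g z) h) UNIV"
    by (intro hardy_inner_has_sum hardy_space_add assms)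
  show "((\<lambda>\<alpha>. hcoef (\<lambda>z. f z + g z) \<alpha> * cnj (hcoef h \<alpha>)) has_sum hardy_inner f h + hardy_inner g h) UNIV"
    using has_sum_add[OF hardy_inner_has_sum[OF assms(1,3)] hardy_inner_has_sum[OF assms(2,3)]] assms
    by (simp add: hcoef_add hardy_space_iff distrib_right)
qed

lemma hardy_inner_cmult_left:
  assumes "f \<in> hardy_space" "h \<in> hardy_space"
  shows "hardy_inner (\<lambda>z. c * f z) h = c * hardy_inner f h"
proof (rule has_sum_unique)
  show "((\<lambda>\<alpha>. hcoef (\<lambda>z. c * f z) \<alpha> * cnj (hcoef h \<alpha>)) has_sum hardy_inner (\<lambda>z. c * f z) h) UNIV"
    by (intro hardy_inner_has_sum hardy_space_cmult assms)
  show "((\<lambda>\<alpha>. hcoef (\<lambda>z. c * f z) \<alpha> * cnj (hcoef h \<alpha>)) has_sum c * hardy_inner f h) UNIV"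
    using has_sum_cmult_right[OF hardy_inner_has_sum[OF assms], of c] assms
    by (simp add: hcoef_cmult hardy_space_iff mult.assoc)
qed

lemma hardy_inner_cmult_right:
  assumes "f \<in> hardy_space" "h \<in> hardy_space"
  shows "hardy_inner f (\<lambda>z. c * h z) = cnj c * hardy_inner f h"
  using hardy_inner_cmult_left[OF assms(2,1), of c] hardy_inner_cnj assms hardy_space_cmult
  by (metis complex_cnj_mult)

text \<open>The finite inequality holds for every finite set of multi-indices with a bound that does
  not depend on the set, and so passes to the limit of the partial sums.\<close>

lemma hardy_Cauchy_Schwarz:
  assumes f: "f \<in> hardy_space" and g: "g \<in> hardy_space"
  shows "cmod (hardy_inner f g) \<le> hardy_norm f * hardy_norm g"
proof -
  have L2: "L2_set (\<lambda>\<alpha>. cmod (hcoef h \<alpha>)) X \<le> hardy_norm h" if "finite X" "h \<in> hardy_space" for X h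
  proof -
    have "(\<Sum>\<alpha>\<in>X. (cmod (hcoef h \<alpha>))\<^sup>2) \<le> (hardy_norm h)\<^sup>2"
      unfolding hardy_norm_power2[OF that(2)] using that by (intro finite_sum_le_infsum) (auto simp: hardy_space_iff)
    thus ?thesis unfolding L2_set_def by (simp add: real_le_lsqrt real_sqrt_le_iff hardy_norm_nonneg sum_nonneg)
  qed
  have "cmod (\<Sum>\<alpha>\<in>X. hcoef f \<alpha> * cnj (hcoef g \<alpha>)) \<le> hardy_norm f * hardy_norm g" if X: "finite X" for X
  proof -
    have "cmod (\<Sum>\<alpha>\<in>X. hcoef f \<alpha> * cnj (hcoef g \<alpha>)) \<le> (\<Sum>\<alpha>\<in>X. \<bar>cmod (hcoef f \<alpha>)\<bar> * \<bar>cmod (hcoef g \<alpha>)\<bar>)"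
      by (rule sum_norm_le) (simp add: norm_mult)
    also have "\<dots> \<le> L2_set (\<lambda>\<alpha>. cmod (hcoef f \<alpha>)) X * L2_set (\<lambda>\<alpha>. cmod (hcoef g \<alpha>)) X"
      by (rule L2_set_mult_ineq)
    also have "\<dots> \<le> hardy_norm f * hardy_norm g"
      by (intro mult_mono L2 X f g hardy_norm_nonneg L2_set_nonneg)
    finally show ?thesis .
  qed
  moreover have "((\<lambda>X. \<Sum>\<alpha>\<in>X. hcoef f \<alpha> * cnj (hcoef g \<alpha>)) \<longlongrightarrow> hardy_inner f g) (finite_subsets_at_top UNIV)"
    using hardy_inner_has_sum[OF f g] by (simp add: has_sum_def)
  ultimately show ?thesis
    by (intro Lim_norm_ubound[OF finite_subsets_at_top_neq_bot]) (auto intro: eventually_finite_subsets_at_top_weakI)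
qed

section \<open>Differentiation and reproducing kernels\<close>

lemma mpow_upd: "mpow (upd z i w) \<alpha> = w ^ \<alpha> i * (\<Prod>j\<in>UNIV - {i}. z $ j ^ \<alpha> j)"
  unfolding mpow_def by (subst prod.remove[of UNIV i]) (auto intro!: prod.cong)

lemma mpow_fun_upd: "mpow z (\<alpha>(i := m)) = z $ i ^ m * (\<Prod>j\<in>UNIV - {i}. z $ j ^ \<alpha> j)"
  unfolding mpow_def by (subst prod.remove[of UNIV i]) (auto intro!: prod.cong)

text \<open>The exponents \<open>\<gamma>\<close> need not be injective, so that differentiation can be iterated without reindexing.
  Where the subtraction truncates, the factor in front vanishes.\<close>

lemma partial_deriv_has_sum:
  fixes b :: "'a \<Rightarrow> complex" and \<gamma> :: "'a \<Rightarrow> 'n::finite \<Rightarrow> nat"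
  assumes f: "\<And>z. z \<in> polydisk \<Longrightarrow> ((\<lambda>s. b s * mpow z (\<gamma> s)) has_sum f z) A"
    and z: "z \<in> polydisk"
  shows "((\<lambda>s. b s * of_nat (\<gamma> s i) * mpow z ((\<gamma> s)(i := \<gamma> s i - 1))) has_sum partial_deriv i f z) A"
proof -
  \<comment> \<open>Chosen so that |z_i| + \<delta> = \<rho> < 1: the closed disk of radius \<delta>
    around z_i lies in the closed disk of radius \<rho> around 0, which is still inside the unit
    disk.\<close>
  define \<delta> where "\<delta> = (1 - cmod (z $ i)) / 2"
  define \<rho> where "\<rho> = (1 + cmod (z $ i)) / 2"
  define m where "m = (\<lambda>s. \<Prod>j\<in>UNIV - {i}. z $ j ^ \<gamma> s j)"
  have zi: "cmod (z $ i) < 1" using z by (simp add: polydisk_iff)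
  hence \<delta>: "\<delta> > 0" and \<rho>: "0 < \<rho>" "\<rho> < 1"
    using norm_ge_zero[of "z $ i"] by (simp_all add: \<delta>_def \<rho>_def del: norm_ge_zero)
  have w: "cmod w \<le> \<rho>" if "w \<in> cball (z $ i) \<delta>" for w
    using that norm_triangle_ineq2[of w "z $ i"] by (simp add: \<delta>_def \<rho>_def dist_norm norm_minus_commute field_simps)
  define F where "F = (\<lambda>X w. \<Sum>s\<in>X. b s * (w ^ \<gamma> s i * m s))"
  define F' where "F' = (\<lambda>X w. \<Sum>s\<in>X. b s * (of_nat (\<gamma> s i) * w ^ (\<gamma> s i - 1) * m s))"
  have tm: "b s * mpow (upd z i w) (\<gamma> s) = b s * (w ^ \<gamma> s i * m s)" for s w
    by (simp add: mpow_upd m_def)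
  \<comment> \<open>Replacing the coordinate by \<rho> can only enlarge the modulus of a term, so
    absolute convergence at \<rho> is a Weierstrass majorant on the small disk. Uniform convergence
    of the finite sums then yields convergence of their derivatives.\<close>
  have "uniform_limit (cball (z $ i) \<delta>) F (\<lambda>w. f (upd z i w)) (finite_subsets_at_top A)"
    unfolding F_def
  proof (rule Weierstrass_m_test_general')
    fix s w assume "w \<in> cball (z $ i) \<delta>"
    hence "cmod w ^ \<gamma> s i \<le> \<rho> ^ \<gamma> s i" using w by (intro power_mono) auto
    thus "norm (b s * (w ^ \<gamma> s i * m s)) \<le> norm (b s * mpow (upd z i (of_real \<rho>)) (\<gamma> s))"
      using \<rho> by (simp add: tm norm_mult norm_power mult_left_mono mult_right_mono)
  next
    fix w assume "w \<in> cball (z $ i) \<delta>"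
    hence "cmod w < 1" using w \<rho> by fastforce
    from f[OF upd_in_polydisk[OF z this, of i]] show "((\<lambda>s. b s * (w ^ \<gamma> s i * m s)) has_sum f (upd z i w)) A"
      by (simp only: tm)
  next
    have "((\<lambda>s. b s * mpow (upd z i (of_real \<rho>)) (\<gamma> s)) has_sum f (upd z i (of_real \<rho>))) A"
      using \<rho> by (intro f upd_in_polydisk z) auto
    thus "(\<lambda>s. norm (b s * mpow (upd z i (of_real \<rho>)) (\<gamma> s))) summable_on A"
      by (metis has_sum_imp_summable summable_on_iff_abs_summable_on_complex)
  qed
  moreover have "\<forall>\<^sub>F X in finite_subsets_at_top A. continuous_on (cball (z $ i) \<delta>) (F X) \<and>
      (\<forall>w\<in>ball (z $ i) \<delta>. (F X has_field_derivative F' X w) (at w))"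
    unfolding F_def F'_def
    by (intro always_eventually allI conjI ballI continuous_intros)
       (auto intro!: derivative_eq_intros sum.cong simp: mult_ac)
  ultimately obtain g' where g': "\<And>w. w \<in> ball (z $ i) \<delta> \<Longrightarrow>
      ((\<lambda>w. f (upd z i w)) has_field_derivative g' w) (at w) \<and> ((\<lambda>X. F' X w) \<longlongrightarrow> g' w) (finite_subsets_at_top A)"
    using \<delta> by (elim has_complex_derivative_uniform_limit[rotated]) auto
  have "partial_deriv i f z = g' (z $ i)"
    unfolding partial_deriv_def using g'[of "z $ i"] \<delta> by (auto intro: DERIV_imp_deriv)
  moreover have "((\<lambda>s. b s * (of_nat (\<gamma> s i) * (z $ i) ^ (\<gamma> s i - 1) * m s)) has_sum g' (z $ i)) A"
    using g'[of "z $ i"] \<delta> by (simp add: has_sum_def F'_def)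
  ultimately show ?thesis by (simp add: mpow_fun_upd m_def mult_ac)
qed

text \<open>The falling factorial n (n - 1) ... (n - j + 1) left by j differentiations of a power is
  encoded as \<open>fact j * of_nat (n choose j)\<close>; one more differentiation contributes the
  factor n - j.\<close>

lemma fact_binomial_Suc:
  "fact j * of_nat (n choose j) * of_nat (n - j) = (fact (Suc j) * of_nat (n choose Suc j) :: complex)"
proof -
  have "Suc j * (n choose Suc j) = (n choose j) * (n - j)"
    using binomial_absorption[of j n] binomial_absorb_comp[of n j] by (simp add: mult.commute)
  hence "of_nat (Suc j) * of_nat (n choose Suc j) = (of_nat (n choose j) * of_nat (n - j) :: complex)"
    by (metis of_nat_mult)
  thus ?thesis by (simp add: fact_Suc mult.assoc mult.left_commute)
qed

lemma partial_deriv_funpow_has_sum: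
  fixes b :: "'a \<Rightarrow> complex" and \<gamma> :: "'a \<Rightarrow> 'n::finite \<Rightarrow> nat"
  assumes f: "\<And>z. z \<in> polydisk \<Longrightarrow> ((\<lambda>s. b s * mpow z (\<gamma> s)) has_sum f z) A"
    and z: "z \<in> polydisk"
  shows "((\<lambda>s. b s * (fact j * of_nat (\<gamma> s i choose j)) * mpow z ((\<gamma> s)(i := \<gamma> s i - j))) has_sum
    (partial_deriv i ^^ j) f z) A"
  using z
proof (induction j arbitrary: z)
  case 0
  thus ?case using f by simp
next
  case (Suc j)
  from partial_deriv_has_sum[OF Suc.IH Suc.prems, of i] show ?case
    by (simp add: mult.assoc fact_binomial_Suc[unfolded mult.assoc] fun_upd_def cong: if_cong del: fact_Suc binomial_Suc_Suc)
qed

lemma mixed_partial_has_sum: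
  fixes b :: "'a \<Rightarrow> complex" and \<gamma> :: "'a \<Rightarrow> 'n::{finite,linorder} \<Rightarrow> nat"
  assumes f: "\<And>z. z \<in> polydisk \<Longrightarrow> ((\<lambda>s. b s * mpow z (\<gamma> s)) has_sum f z) A"
    and z: "z \<in> polydisk"
  shows "((\<lambda>s. b s * (\<Prod>i\<in>UNIV. fact (k i) * of_nat (\<gamma> s i choose k i)) * mpow z (\<lambda>i. \<gamma> s i - k i)) has_sum
    mixed_partial k f z) A"
proof -
  have "((\<lambda>s. b s * (\<Prod>i\<in>set xs. fact (k i) * of_nat (\<gamma> s i choose k i)) *
      mpow z (\<lambda>i. if i \<in> set xs then \<gamma> s i - k i else \<gamma> s i)) has_sum
      foldr (\<lambda>i. partial_deriv i ^^ k i) xs f z) A" if "distinct xs" "z \<in> polydisk" for xs z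
    using that
  proof (induction xs arbitrary: z)
    case Nil
    thus ?case using f by simp
  next
    case (Cons x xs)
    \<comment> \<open>The list has no repetitions, so coordinate \<open>x\<close> has not been
      differentiated yet and every conditional on \<open>x \<in> set xs\<close> takes its second
      branch.\<close>
    have "((\<lambda>s. (b s * (\<Prod>i\<in>set xs. fact (k i) * of_nat (\<gamma> s i choose k i))) * (fact (k x) *
          of_nat ((if x \<in> set xs then \<gamma> s x - k x else \<gamma> s x) choose k x)) *
        mpow z ((\<lambda>i. if i \<in> set xs then \<gamma> s i - k i else \<gamma> s i)
          (x := (if x \<in> set xs then \<gamma> s x - k x else \<gamma> s x) - k x))) has_sum
        (partial_deriv x ^^ k x) (foldr (\<lambda>i. partial_deriv i ^^ k i) xs f) z) A"
      using Cons by (intro partial_deriv_funpow_has_sum) auto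
    also have "(\<lambda>s. (\<lambda>i. if i \<in> set xs then \<gamma> s i - k i else \<gamma> s i)
          (x := (if x \<in> set xs then \<gamma> s x - k x else \<gamma> s x) - k x)) =
        (\<lambda>s i. if i \<in> set (x # xs) then \<gamma> s i - k i else \<gamma> s i)"
      using Cons.prems by (auto simp: fun_eq_iff)
    finally show ?case using Cons.prems by (simp add: mult_ac fun_upd_def)
  qed
  from this[of "sorted_list_of_set UNIV" z] z show ?thesis
    by (simp add: mixed_partial_def)
qed

lemma mixed_partial_0:
  fixes f :: "complex ^ 'n::{finite,linorder} \<Rightarrow> complex"
  shows "mixed_partial (\<lambda>_. 0) f = f"
proof -
  have "foldr (\<lambda>i. partial_deriv i ^^ 0) xs f = f" for xs :: "'n list"
    by (induction xs) auto
  thus ?thesis by (simp only: mixed_partial_def)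
qed

section \<open>Expansion and reproducing property of the kernels\<close>

lemma binomial_series:
  fixes y :: complex
  assumes y: "cmod y < 1"
  shows "((\<lambda>n. of_nat ((n + k) choose k) * y ^ n) has_sum 1 / (1 - y) ^ (k + 1)) UNIV"
proof -
  have *: "(\<lambda>n. of_nat ((n + k) choose k) * x ^ n) sums (1 / (1 - x) ^ (k + 1))" if "cmod x < 1" for x :: complex
  proof -
    \<comment> \<open>Newton's series for the exponent -(k + 1); negating the upper index turns its
      coefficients into \<open>(n + k) choose k\<close>.\<close>
    have "(\<lambda>n. ((- of_nat (k + 1)) gchoose n) * (- x) ^ n) sums (1 + - x) powr (- of_nat (k + 1))"
      using that by (intro gen_binomial_complex) auto
    also have "(\<lambda>n. ((- of_nat (k + 1)) gchoose n) * (- x) ^ n) = (\<lambda>n. of_nat ((n + k) choose k) * x ^ n)"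
    proof
      fix n
      have "((- of_nat (k + 1)) gchoose n) = (- 1) ^ n * ((of_nat (k + 1) + of_nat n - 1 :: complex) gchoose n)"
        by (rule gbinomial_minus)
      also have "(of_nat (k + 1) + of_nat n - 1 :: complex) = of_nat (n + k)" by simp
      also have "(of_nat (n + k) :: complex) gchoose n = of_nat ((n + k) choose n)"
        by (rule binomial_gbinomial[symmetric])
      also have "(n + k) choose n = (n + k) choose k"
        using binomial_symmetric[of n "n + k"] by simp
      finally have "((- of_nat (k + 1)) gchoose n) * (- x) ^ n =
          ((- 1) ^ n * of_nat ((n + k) choose k)) * ((- 1) ^ n * x ^ n)"
        unfolding power_minus[of x] by (rule arg_cong)
      also have "\<dots> = ((- 1) ^ n * (- 1) ^ n) * (of_nat ((n + k) choose k) * x ^ n)"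
        by (simp only: mult_ac)
      also have "(- 1) ^ n * (- 1) ^ n = (1 :: complex)"
        by (simp flip: power_mult_distrib)
      finally show "((- of_nat (k + 1)) gchoose n) * (- x) ^ n = of_nat ((n + k) choose k) * x ^ n"
        by simp
    qed
    also have "(1 + - x) powr (- of_nat (k + 1)) = 1 / (1 - x) ^ (k + 1)"
    proof -
      have "1 - x \<noteq> 0" using that by auto
      thus ?thesis using powr_nat'[of "1 - x" "k + 1"] by (simp add: powr_minus inverse_eq_divide del: of_nat_Suc of_nat_add)
    qed
    finally show ?thesis .
  qed
  \<comment> \<open>Convergence at a point of larger modulus gives absolute convergence at
    \<open>y\<close>, which the unordered sum requires.\<close>
  obtain x :: real where x: "cmod y < x" "x < 1" using y dense by blast
  hence x': "cmod (complex_of_real x) = x" using order.strict_trans1[OF norm_ge_zero x(1)] by simp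
  have "summable (\<lambda>n. norm (of_nat ((n + k) choose k) * y ^ n))"
    using sums_summable[OF *[of "of_real x"]] x x' by (intro powser_insidea[of _ "of_real x"]) auto
  thus ?thesis using *[OF y] by (rule norm_summable_imp_has_sum)
qed

text \<open>The binomial series in x z, shifted by k. The terms with n < k carry a zero binomial, so
  the sum may run over all n; this gives the coefficients exactly the shape that termwise
  differentiation produces in \<open>mixed_partial_has_sum\<close>.\<close>

lemma kernel_series:
  fixes x z :: complex
  assumes "cmod x < 1" "cmod z < 1"
  shows "((\<lambda>n. of_nat (n choose k) * x ^ (n - k) * z ^ n) has_sum z ^ k / (1 - x * z) ^ (k + 1)) UNIV"
proof -
  have "cmod (x * z) < 1"
    using assms by (metis mult.right_neutral mult_strict_mono' norm_ge_zero norm_mult)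
  hence "((\<lambda>n. z ^ k * (of_nat ((n + k) choose k) * (x * z) ^ n)) has_sum z ^ k * (1 / (1 - x * z) ^ (k + 1))) UNIV"
    by (intro has_sum_cmult_right binomial_series)
  also have "(\<lambda>n. z ^ k * (of_nat ((n + k) choose k) * (x * z) ^ n)) =
      (\<lambda>n. (\<lambda>n. of_nat (n choose k) * x ^ (n - k) * z ^ n) (n + k))"
    by (simp add: power_add power_mult_distrib mult_ac)
  finally have "((\<lambda>n. of_nat (n choose k) * x ^ (n - k) * z ^ n) has_sum z ^ k * (1 / (1 - x * z) ^ (k + 1))) {k..}"
    by (subst (asm) has_sum_reindex_bij_betw[of "\<lambda>n. n + k" UNIV "{k..}"])
       (auto intro!: bij_betwI[of _ _ _ "\<lambda>n. n - k"])
  also have "?this \<longleftrightarrow> ((\<lambda>n. of_nat (n choose k) * x ^ (n - k) * z ^ n) has_sum z ^ k * (1 / (1 - x * z) ^ (k + 1))) UNIV"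
    by (rule has_sum_cong_neutral) (auto simp: binomial_eq_0)
  finally show ?thesis by simp
qed

text \<open>The kernel that represents the functional sending \<open>f\<close> to \<open>mixed_partial k f w\<close>; for \<open>k = 0\<close> it is the
  Szego kernel.\<close>

definition kern :: "('n::finite \<Rightarrow> nat) \<Rightarrow> complex ^ 'n \<Rightarrow> complex ^ 'n \<Rightarrow> complex" where
  "kern k w z = (if z \<in> polydisk then
     \<Prod>i\<in>UNIV. fact (k i) * (z $ i ^ k i / (1 - cnj (w $ i) * z $ i) ^ (k i + 1)) else 0)"

lemma one_minus_mult_ne_0: "cmod x < 1 \<Longrightarrow> cmod y < 1 \<Longrightarrow> 1 - x * y \<noteq> 0"
proof
  assume "cmod x < 1" "cmod y < 1" "1 - x * y = 0"
  hence "x * y = 1" by simp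
  hence "cmod x * cmod y = 1" by (metis norm_mult norm_one)
  thus False using \<open>cmod x < 1\<close> \<open>cmod y < 1\<close> by (metis mult.right_neutral mult_strict_mono' norm_ge_zero less_irrefl)
qed

lemma kern_analytic0:
  fixes w :: "complex ^ 'n::finite"
  assumes w: "w \<in> polydisk"
  shows "analytic0 (kern k w)"
  unfolding analytic0_def analytic_polydisk_def
proof (intro conjI ballI allI impI)
  have ne: "1 - cnj (w $ i) * z $ i \<noteq> 0" if "z \<in> polydisk" for i z
    using w that by (intro one_minus_mult_ne_0) (auto simp: polydisk_iff)
  have "continuous_on polydisk (\<lambda>z. \<Prod>i\<in>UNIV. fact (k i) * (z $ i ^ k i / (1 - cnj (w $ i) * z $ i) ^ (k i + 1)))"
    by (intro continuous_intros) (use ne in auto)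
  thus "continuous_on polydisk (kern k w)"
    by (rule continuous_on_cong[THEN iffD1, rotated 2]) (auto simp: kern_def)
  fix z :: "complex ^ 'n" and i assume z: "z \<in> polydisk"
  have up: "upd z i v \<in> polydisk" if "v \<in> ball 0 1" for v
    using z that by (intro upd_in_polydisk) auto
  have "(\<lambda>v. \<Prod>j\<in>UNIV. fact (k j) * (upd z i v $ j ^ k j / (1 - cnj (w $ j) * upd z i v $ j) ^ (k j + 1))) holomorphic_on ball 0 1"
  proof (intro holomorphic_intros)
    show "(\<lambda>v. upd z i v $ j) holomorphic_on ball 0 1" for j
      by (cases "j = i") (auto intro: holomorphic_intros)
    thus "(\<lambda>v. upd z i v $ j) holomorphic_on ball 0 1" for j .
    show "(1 - cnj (w $ j) * upd z i v $ j) ^ (k j + 1) \<noteq> 0" if "v \<in> ball 0 1" for j v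
      using ne[OF up[OF that], of j] by simp
  qed
  thus "(\<lambda>v. kern k w (upd z i v)) holomorphic_on ball 0 1"
    by (rule holomorphic_cong[THEN iffD1, rotated 2]) (auto simp: kern_def up)
qed (auto simp: kern_def)

lemma kern_has_sum:
  fixes w :: "complex ^ 'n::finite"
  assumes w: "w \<in> polydisk" and z: "z \<in> polydisk"
  shows "((\<lambda>\<alpha>. (\<Prod>i\<in>UNIV. fact (k i) * of_nat (\<alpha> i choose k i)) * cnj (mpow w (\<lambda>i. \<alpha> i - k i)) * mpow z \<alpha>)
    has_sum kern k w z) UNIV"
proof -
  define F :: "'n \<Rightarrow> nat \<Rightarrow> complex"
    where "F = (\<lambda>i n. fact (k i) * (of_nat (n choose k i) * cnj (w $ i) ^ (n - k i) * z $ i ^ n))"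
  have *: "(F i has_sum fact (k i) * (z $ i ^ k i / (1 - cnj (w $ i) * z $ i) ^ (k i + 1))) UNIV" for i
    unfolding F_def using w z by (intro has_sum_cmult_right kernel_series) (auto simp: polydisk_iff)
  have "((\<lambda>\<alpha>. \<Prod>i\<in>UNIV. F i (\<alpha> i)) has_sum (\<Prod>i\<in>UNIV. infsum (F i) UNIV)) UNIV"
    using * by (intro has_sum_prod_UNIV(2)) (metis has_sum_imp_summable summable_on_iff_abs_summable_on_complex)
  also have "(\<Prod>i\<in>UNIV. infsum (F i) UNIV) = kern k w z"
    using z infsumI[OF *] by (simp add: kern_def)
  also have "(\<lambda>\<alpha>. \<Prod>i\<in>UNIV. F i (\<alpha> i)) = (\<lambda>\<alpha>. (\<Prod>i\<in>UNIV. fact (k i) * of_nat (\<alpha> i choose k i)) *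
      cnj (mpow w (\<lambda>i. \<alpha> i - k i)) * mpow z \<alpha>)"
    by (simp add: F_def mpow_def prod.distrib mult_ac)
  finally show ?thesis .
qed

lemma hcoef_kern:
  assumes "w \<in> polydisk"
  shows "hcoef (kern k w) = (\<lambda>\<alpha>. (\<Prod>i\<in>UNIV. fact (k i) * of_nat (\<alpha> i choose k i)) * cnj (mpow w (\<lambda>i. \<alpha> i - k i)))"
  by (intro hcoef_unique analytic0_borel kern_analytic0 kern_has_sum assms)

text \<open>From |1 - cnj(w_i) z_i| >= 1 - |w_i| the kernel is bounded on the polydisk, and on a
  probability space a bounded function has bounded mean squares. \<open>B\<close> is the product of
  the one-variable bounds.\<close>

lemma kern_hardy:
  fixes w :: "complex ^ 'n::finite"
  assumes w: "w \<in> polydisk"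
  shows "kern k w \<in> hardy_space"
proof -
  define B where "B = (\<Prod>i\<in>UNIV. fact (k i) * (1 / (1 - cmod (w $ i)) ^ (k i + 1)))"
  have w1: "cmod (w $ i) < 1" for i using w by (simp add: polydisk_iff)
  have bound: "cmod (kern k w z) \<le> B" if "z \<in> polydisk" for z
  proof -
    have "cmod (fact (k i) * (z $ i ^ k i / (1 - cnj (w $ i) * z $ i) ^ (k i + 1))) \<le>
        fact (k i) * (1 / (1 - cmod (w $ i)) ^ (k i + 1))" for i
    proof -
      have zi: "cmod (z $ i) < 1" using that by (simp add: polydisk_iff)
      hence "cmod (cnj (w $ i) * z $ i) \<le> cmod (w $ i)" by (simp add: norm_mult mult_left_le)
      hence "1 - cmod (w $ i) \<le> cmod (1 - cnj (w $ i) * z $ i)"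
        using norm_triangle_ineq2[of 1 "cnj (w $ i) * z $ i"] by simp
      hence "(1 - cmod (w $ i)) ^ (k i + 1) \<le> cmod (1 - cnj (w $ i) * z $ i) ^ (k i + 1)"
        using w1[of i] by (intro power_mono) auto
      moreover have "cmod (z $ i) ^ k i \<le> 1" using zi by (simp add: power_le_one)
      ultimately have "cmod (z $ i) ^ k i / cmod (1 - cnj (w $ i) * z $ i) ^ (k i + 1) \<le> 1 / (1 - cmod (w $ i)) ^ (k i + 1)"
        using w1[of i] by (intro frac_le) auto
      thus ?thesis by (simp only: norm_mult norm_divide norm_power norm_fact) (intro mult_left_mono, auto)
    qed
    moreover have "cmod (kern k w z) =
        (\<Prod>i\<in>UNIV. cmod (fact (k i) * (z $ i ^ k i / (1 - cnj (w $ i) * z $ i) ^ (k i + 1))))"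
      using that by (simp only: kern_def if_True prod_norm)
    ultimately show ?thesis unfolding B_def by (simp only:) (intro prod_mono conjI norm_ge_zero)
  qed
  have "hardy_norm_sq (kern k w) \<le> ennreal (B\<^sup>2)"
    unfolding hardy_norm_sq_def
  proof (rule SUP_least)
    fix r :: real assume r: "r \<in> {0<..<1}"
    have "(\<integral>\<^sup>+ \<zeta>. ennreal ((cmod (kern k w (r *\<^sub>R \<zeta>)))\<^sup>2) \<partial>torus_measure) \<le> (\<integral>\<^sup>+ \<zeta>. ennreal (B\<^sup>2) \<partial>(torus_measure :: (complex ^ 'n) measure))"
    proof (rule nn_integral_mono_AE)
      show "AE \<zeta> in torus_measure. ennreal ((cmod (kern k w (r *\<^sub>R \<zeta>)))\<^sup>2) \<le> ennreal (B\<^sup>2)"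
        using AE_torus
      proof eventually_elim
        case (elim \<zeta>)
        have "cmod (kern k w (r *\<^sub>R \<zeta>)) \<le> B" using elim r by (intro bound) (simp add: polydisk_iff)
        thus ?case by (intro ennreal_leI power_mono) auto
      qed
    qed
    also have "\<dots> = ennreal (B\<^sup>2)" by (simp add: torus.emeasure_space_1[simplified])
    finally show "(\<integral>\<^sup>+ \<zeta>. ennreal ((cmod (kern k w (r *\<^sub>R \<zeta>)))\<^sup>2) \<partial>torus_measure) \<le> ennreal (B\<^sup>2)" .
  qed
  hence "hardy_norm_sq (kern k w) < \<infinity>"
    by (metis ennreal_less_top infinity_ennreal_def le_less_trans)
  thus ?thesis using kern_analytic0[OF w, of k] by (simp add: hardy_space_def analytic0_def)
qed

text \<open>The conjugated coefficients of the kernel are precisely the factors that termwise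
  differentiation at \<open>w\<close> attaches to the coefficients of \<open>f\<close>, so both
  sides are sums of the same series.\<close>

lemma hardy_inner_kern:
  fixes f :: "complex ^ 'n::{finite,linorder} \<Rightarrow> complex"
  assumes f: "f \<in> hardy_space" and w: "w \<in> polydisk"
  shows "hardy_inner f (kern k w) = mixed_partial k f w"
proof (rule has_sum_unique)
  show "((\<lambda>\<alpha>. hcoef f \<alpha> * cnj (hcoef (kern k w) \<alpha>)) has_sum hardy_inner f (kern k w)) UNIV"
    by (intro hardy_inner_has_sum f kern_hardy w)
  have "((\<lambda>\<alpha>. hcoef f \<alpha> * (\<Prod>i\<in>UNIV. fact (k i) * of_nat (\<alpha> i choose k i)) * mpow w (\<lambda>i. \<alpha> i - k i))
      has_sum mixed_partial k f w) UNIV"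
    using f w by (intro mixed_partial_has_sum[where \<gamma> = "\<lambda>\<alpha>. \<alpha>"] hcoef_has_sum) (auto simp: hardy_space_iff)
  thus "((\<lambda>\<alpha>. hcoef f \<alpha> * cnj (hcoef (kern k w) \<alpha>)) has_sum mixed_partial k f w) UNIV"
    by (simp add: hcoef_kern[OF w] mult_ac)
qed

section \<open>Conjugation, adjoints and density of the kernels\<close>

definition vcnj :: "complex ^ 'n \<Rightarrow> complex ^ 'n" where
  "vcnj z = (\<chi> i. cnj (z $ i))"

lemma vcnj_nth [simp]: "vcnj z $ i = cnj (z $ i)"
  by (simp add: vcnj_def)

lemma vcnj_vcnj [simp]: "vcnj (vcnj z) = z"
  by (simp add: vec_eq_iff)

lemma vcnj_polydisk [simp]: "vcnj z \<in> polydisk \<longleftrightarrow> z \<in> polydisk"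
  by (simp add: polydisk_iff)

lemma mpow_vcnj: "mpow (vcnj z) \<alpha> = cnj (mpow z \<alpha>)"
  by (simp add: mpow_def)

lemma std_conjugation_vcnj: "std_conjugation f z = cnj (f (vcnj z))"
  by (simp add: std_conjugation_def vcnj_def)

lemma std_conjugation_idem [simp]: "std_conjugation (std_conjugation f) = f"
  by (simp add: std_conjugation_vcnj fun_eq_iff)

lemma analytic0_std_conjugation:
  fixes f :: "complex ^ 'n::finite \<Rightarrow> complex"
  assumes f: "analytic0 f"
  shows "analytic0 (std_conjugation f)"
  unfolding analytic0_def analytic_polydisk_def
proof (intro conjI ballI allI impI)
  have "continuous_on polydisk f"
    using f by (simp add: analytic0_def analytic_polydisk_def)
  moreover have "continuous_on polydisk (vcnj :: complex ^ 'n \<Rightarrow> _)"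
    unfolding vcnj_def[abs_def] by (intro continuous_intros)
  ultimately have "continuous_on polydisk (\<lambda>z. f (vcnj z))"
    by (rule continuous_on_compose2) auto
  thus "continuous_on polydisk (std_conjugation f)"
    unfolding std_conjugation_vcnj[abs_def] by (intro continuous_intros)
next
  fix z :: "complex ^ 'n" and i assume z: "z \<in> polydisk"
  have "cnj ` ball 0 1 = ball 0 1"
    by (auto simp: image_cnj_conv_vimage_cnj)
  moreover have "(\<lambda>w. f (upd (vcnj z) i w)) holomorphic_on ball 0 1"
    using f z by (simp add: analytic0_def analytic_polydisk_def)
  ultimately have "cnj \<circ> (\<lambda>w. f (upd (vcnj z) i w)) \<circ> cnj holomorphic_on ball 0 1"
    by (intro holomorphic_on_compose_cnj_cnj) auto
  also have "cnj \<circ> (\<lambda>w. f (upd (vcnj z) i w)) \<circ> cnj = (\<lambda>w. std_conjugation f (upd z i w))"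
  proof
    fix w
    have "vcnj (upd z i w) = upd (vcnj z) i (cnj w)" by (simp add: vec_eq_iff)
    thus "(cnj \<circ> (\<lambda>w. f (upd (vcnj z) i w)) \<circ> cnj) w = std_conjugation f (upd z i w)"
      by (simp add: std_conjugation_vcnj)
  qed
  finally show "(\<lambda>w. std_conjugation f (upd z i w)) holomorphic_on ball 0 1" .
next
  fix z :: "complex ^ 'n" assume "z \<notin> polydisk"
  thus "std_conjugation f z = 0" using f by (simp add: std_conjugation_vcnj analytic0_def)
qed

lemma hcoef_std_conjugation:
  fixes f :: "complex ^ 'n::finite \<Rightarrow> complex"
  assumes f: "analytic0 f"
  shows "hcoef (std_conjugation f) = (\<lambda>\<alpha>. cnj (hcoef f \<alpha>))"
proof (intro hcoef_unique analytic0_borel analytic0_std_conjugation f)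
  fix z :: "complex ^ 'n" assume "z \<in> polydisk"
  hence "((\<lambda>\<alpha>. cnj (hcoef f \<alpha> * mpow (vcnj z) \<alpha>)) has_sum cnj (f (vcnj z))) UNIV"
    by (subst has_sum_cnj_iff) (intro hcoef_has_sum f, simp)
  thus "((\<lambda>\<alpha>. cnj (hcoef f \<alpha>) * mpow z \<alpha>) has_sum std_conjugation f z) UNIV"
    by (simp add: mpow_vcnj std_conjugation_vcnj)
qed

lemma std_conjugation_hardy: "f \<in> hardy_space \<Longrightarrow> std_conjugation f \<in> hardy_space"
  by (simp add: hardy_space_iff analytic0_std_conjugation hcoef_std_conjugation)

lemma hardy_inner_std_conjugation:
  assumes "f \<in> hardy_space" "g \<in> hardy_space"
  shows "hardy_inner (std_conjugation f) (std_conjugation g) = cnj (hardy_inner f g)"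
proof (rule has_sum_unique)
  show "((\<lambda>\<alpha>. hcoef (std_conjugation f) \<alpha> * cnj (hcoef (std_conjugation g) \<alpha>)) has_sum
      hardy_inner (std_conjugation f) (std_conjugation g)) UNIV"
    by (intro hardy_inner_has_sum std_conjugation_hardy assms)
  have "((\<lambda>\<alpha>. cnj (hcoef f \<alpha> * cnj (hcoef g \<alpha>))) has_sum cnj (hardy_inner f g)) UNIV"
    by (subst has_sum_cnj_iff) (intro hardy_inner_has_sum assms)
  thus "((\<lambda>\<alpha>. hcoef (std_conjugation f) \<alpha> * cnj (hcoef (std_conjugation g) \<alpha>)) has_sum
      cnj (hardy_inner f g)) UNIV"
    using assms by (simp add: hcoef_std_conjugation hardy_space_iff)
qed

lemma std_conjugation_kern: "std_conjugation (kern k w) = kern k (vcnj w)"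
  by (auto simp: std_conjugation_vcnj kern_def fun_eq_iff)

lemma hardy_inner_szego:
  fixes f :: "complex ^ 'n::{finite,linorder} \<Rightarrow> complex"
  assumes "f \<in> hardy_space" "w \<in> polydisk"
  shows "hardy_inner f (kern (\<lambda>_. 0) w) = f w"
  using hardy_inner_kern[OF assms] by (simp add: mixed_partial_0)

text \<open>Pairing with a Szego kernel evaluates at a point of the polydisk, and outside both
  functions are 0 by convention. This is the uniqueness behind \<open>hardy_adjoint\<close>.\<close>

lemma hardy_inner_eqI:
  fixes h h' :: "complex ^ 'n::{finite,linorder} \<Rightarrow> complex"
  assumes h: "h \<in> hardy_space" "h' \<in> hardy_space"
    and eq: "\<And>f. f \<in> hardy_space \<Longrightarrow> hardy_inner f h = hardy_inner f h'"
  shows "h = h'"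
proof
  fix w
  show "h w = h' w"
  proof (cases "w \<in> polydisk")
    case True
    note K = kern_hardy[OF True]
    have "hardy_inner h (kern (\<lambda>_. 0) w) = hardy_inner h' (kern (\<lambda>_. 0) w)"
      using hardy_inner_cnj[OF K h(1)] hardy_inner_cnj[OF K h(2)] eq[OF K] by metis
    thus ?thesis using hardy_inner_szego[OF _ True] h by metis
  next
    case False
    thus ?thesis using h by (simp add: hardy_space_def)
  qed
qed

text \<open>Adjoint values are always identified by exhibiting a candidate that satisfies the
  defining identity.\<close>

lemma hardy_adjoint_eqI:
  fixes h :: "complex ^ 'n::{finite,linorder} \<Rightarrow> complex"
  assumes "h \<in> hardy_space" "\<And>f. f \<in> hardy_space \<Longrightarrow> hardy_inner (T f) g = hardy_inner f h"
  shows "hardy_adjoint T g = h"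
  unfolding hardy_adjoint_def
  by (rule the_equality) (use assms in \<open>auto intro!: hardy_inner_eqI\<close>)

section \<open>Monomials, norm convergence of Taylor series, density of the Szego kernels\<close>

definition monomial0 :: "('n::finite \<Rightarrow> nat) \<Rightarrow> complex ^ 'n \<Rightarrow> complex" where
  "monomial0 \<alpha> z = (if z \<in> polydisk then mpow z \<alpha> else 0)"

text \<open>At w = 0 the denominators of \<open>kern \<alpha> w\<close> are 1, so the monomial is a
  scalar multiple of a kernel already known to lie in the space.\<close>

lemma monomial0_hardy: "monomial0 \<alpha> \<in> hardy_space"
proof -
  have "monomial0 \<alpha> = (\<lambda>z. (1 / (\<Prod>i\<in>UNIV. fact (\<alpha> i))) * kern \<alpha> 0 z)"
    by (auto simp: monomial0_def mpow_def kern_def fun_eq_iff prod.distrib)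
  also have "\<dots> \<in> hardy_space"
    by (intro hardy_space_cmult kern_hardy) (simp add: polydisk_iff)
  finally show ?thesis .
qed

lemma hcoef_monomial0: "hcoef (monomial0 \<alpha>) = (\<lambda>\<beta>. if \<beta> = \<alpha> then 1 else 0)"
proof (rule hcoef_unique)
  show "monomial0 \<alpha> \<in> borel_measurable borel"
    using monomial0_hardy[of \<alpha>] by (auto simp: hardy_space_iff intro: analytic0_borel)
  show "((\<lambda>\<beta>. (if \<beta> = \<alpha> then 1 else 0) * mpow z \<beta>) has_sum monomial0 \<alpha> z) UNIV" if "z \<in> polydisk" for z
    using that by (intro has_sum_finite_neutralI[of "{\<alpha>}"]) (auto simp: monomial0_def)
qed

lemma power_series_zero_unique:
  assumes "\<And>z. z \<in> polydisk \<Longrightarrow> ((\<lambda>\<alpha>. b \<alpha> * mpow z \<alpha>) has_sum 0) UNIV"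
  shows "b \<alpha> = 0"
proof -
  have "hcoef (\<lambda>z. 0) = b" by (rule hcoef_unique) (use assms in auto)
  moreover have "hcoef (\<lambda>z. 0) = (\<lambda>_. 0)" by (rule hcoef_unique) auto
  ultimately show ?thesis by metis
qed

lemma hardy_zero: "(\<lambda>z. 0) \<in> hardy_space"
  using hardy_space_cmult[OF monomial0_hardy, of 0] by simp

text \<open>Taylor partial sums converge to \<open>f\<close> in norm, and the bound carries this
  over to \<phi>. The size of the tail is exact: by Parseval its square is the squared norm of
  \<open>f\<close> minus the finite sum of squares.\<close>

lemma bounded_functional_has_sum:
  fixes \<phi> :: "(complex ^ 'n::finite \<Rightarrow> complex) \<Rightarrow> complex"
  assumes add: "\<And>f g. f \<in> hardy_space \<Longrightarrow> g \<in> hardy_space \<Longrightarrow> \<phi> (\<lambda>z. f z + g z) = \<phi> f + \<phi> g"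
    and cmult: "\<And>c f. f \<in> hardy_space \<Longrightarrow> \<phi> (\<lambda>z. c * f z) = c * \<phi> f"
    and bound: "\<And>f. f \<in> hardy_space \<Longrightarrow> cmod (\<phi> f) \<le> C * hardy_norm f"
    and f: "f \<in> hardy_space"
  shows "((\<lambda>\<alpha>. hcoef f \<alpha> * \<phi> (monomial0 \<alpha>)) has_sum \<phi> f) UNIV"
proof -
  define P where "P = (\<lambda>X z. \<Sum>\<alpha>\<in>X. hcoef f \<alpha> * monomial0 \<alpha> z)"
  have P: "P X \<in> hardy_space \<and> \<phi> (P X) = (\<Sum>\<alpha>\<in>X. hcoef f \<alpha> * \<phi> (monomial0 \<alpha>)) \<and>
      hcoef (P X) = (\<lambda>\<beta>. if \<beta> \<in> X then hcoef f \<beta> else 0)" if "finite X" for X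
    using that
  proof (induction X rule: finite_induct)
    case empty
    have "\<phi> (\<lambda>z. 0) = 0" using cmult[OF hardy_zero, of 0] by simp
    moreover have "hcoef (\<lambda>z::complex ^ 'n. 0) = (\<lambda>_. 0)" by (rule hcoef_unique) auto
    ultimately show ?case by (simp add: P_def hardy_zero)
  next
    case (insert \<alpha> X)
    have eq: "P (insert \<alpha> X) = (\<lambda>z. hcoef f \<alpha> * monomial0 \<alpha> z + P X z)"
      using insert by (simp add: P_def)
    have m: "(\<lambda>z. hcoef f \<alpha> * monomial0 \<alpha> z) \<in> hardy_space"
      by (intro hardy_space_cmult monomial0_hardy)
    have "hcoef (P (insert \<alpha> X)) = (\<lambda>\<beta>. hcoef f \<alpha> * (if \<beta> = \<alpha> then 1 else 0) + hcoef (P X) \<beta>)"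
      unfolding eq using m insert.IH monomial0_hardy[of \<alpha>]
      by (simp add: hcoef_add hcoef_cmult hardy_space_iff hcoef_monomial0)
    moreover have "\<phi> (P (insert \<alpha> X)) = hcoef f \<alpha> * \<phi> (monomial0 \<alpha>) + \<phi> (P X)"
      unfolding eq using m insert.IH by (simp add: add cmult monomial0_hardy)
    moreover have "P (insert \<alpha> X) \<in> hardy_space"
      unfolding eq using m insert.IH by (intro hardy_space_add) auto
    moreover from calculation(1) have "hcoef (P (insert \<alpha> X)) = (\<lambda>\<beta>. if \<beta> \<in> insert \<alpha> X then hcoef f \<beta> else 0)"
      using insert by (intro ext) simp
    ultimately show ?case using insert by simp
  qed
  have err: "cmod (\<phi> (P X) - \<phi> f) \<le> \<bar>C\<bar> * sqrt ((hardy_norm f)\<^sup>2 - (\<Sum>\<alpha>\<in>X. (cmod (hcoef f \<alpha>))\<^sup>2))" if X: "finite X" for X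
  proof -
    \<comment> \<open>The tail of \<open>f\<close>, written with the scalar -1 so that additivity
      and homogeneity of \<phi> apply as they are stated.\<close>
    define Q where "Q = (\<lambda>z. f z + (- 1) * P X z)"
    have PX: "P X \<in> hardy_space" "(\<lambda>z. (- 1) * P X z) \<in> hardy_space"
      using P[OF X] hardy_space_cmult by blast+
    have Q: "Q \<in> hardy_space" unfolding Q_def by (intro hardy_space_add f PX)
    have hQ: "hcoef Q = (\<lambda>\<beta>. if \<beta> \<in> X then 0 else hcoef f \<beta>)"
      unfolding Q_def using f PX P[OF X] hcoef_add[of f "\<lambda>z. (- 1) * P X z"] hcoef_cmult[of "P X" "- 1"]
      by (auto simp: hardy_space_iff fun_eq_iff)
    \<comment> \<open>Pythagoras: the squared coefficients of \<open>f\<close> split into those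
      inside \<open>X\<close> and those of the tail.\<close>
    have "((\<lambda>\<beta>. (cmod (hcoef Q \<beta>))\<^sup>2 + (if \<beta> \<in> X then (cmod (hcoef f \<beta>))\<^sup>2 else 0)) has_sum
        (hardy_norm Q)\<^sup>2 + (\<Sum>\<alpha>\<in>X. (cmod (hcoef f \<alpha>))\<^sup>2)) UNIV"
      by (intro has_sum_add hardy_has_sum Q has_sum_finite_neutralI[OF X]) auto
    also have "(\<lambda>\<beta>. (cmod (hcoef Q \<beta>))\<^sup>2 + (if \<beta> \<in> X then (cmod (hcoef f \<beta>))\<^sup>2 else 0)) =
        (\<lambda>\<beta>. (cmod (hcoef f \<beta>))\<^sup>2)"
      by (rule ext) (simp add: hQ)
    finally have "(hardy_norm Q)\<^sup>2 + (\<Sum>\<alpha>\<in>X. (cmod (hcoef f \<alpha>))\<^sup>2) = (hardy_norm f)\<^sup>2"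
      by (rule has_sum_unique[OF _ hardy_has_sum[OF f]])
    hence "(hardy_norm Q)\<^sup>2 = (hardy_norm f)\<^sup>2 - (\<Sum>\<alpha>\<in>X. (cmod (hcoef f \<alpha>))\<^sup>2)"
      by simp
    hence nQ: "hardy_norm Q = sqrt ((hardy_norm f)\<^sup>2 - (\<Sum>\<alpha>\<in>X. (cmod (hcoef f \<alpha>))\<^sup>2))"
      using hardy_norm_nonneg[of Q] by (metis real_sqrt_unique)
    have "\<phi> Q = \<phi> f + (- 1) * \<phi> (P X)"
      unfolding Q_def using add[OF f PX(2)] cmult[OF PX(1), of "- 1"] by simp
    hence "cmod (\<phi> (P X) - \<phi> f) = cmod (\<phi> Q)" by (simp add: norm_minus_commute)
    also have "\<dots> \<le> C * hardy_norm Q" by (rule bound[OF Q])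
    also have "\<dots> \<le> \<bar>C\<bar> * hardy_norm Q" by (intro mult_right_mono hardy_norm_nonneg) auto
    finally show ?thesis unfolding nQ .
  qed
  have "((\<lambda>X. \<bar>C\<bar> * sqrt ((hardy_norm f)\<^sup>2 - (\<Sum>\<alpha>\<in>X. (cmod (hcoef f \<alpha>))\<^sup>2))) \<longlongrightarrow>
      \<bar>C\<bar> * sqrt ((hardy_norm f)\<^sup>2 - (hardy_norm f)\<^sup>2)) (finite_subsets_at_top UNIV)"
    using hardy_has_sum[OF f] by (intro tendsto_intros) (simp add: has_sum_def)
  hence lim: "((\<lambda>X. \<bar>C\<bar> * sqrt ((hardy_norm f)\<^sup>2 - (\<Sum>\<alpha>\<in>X. (cmod (hcoef f \<alpha>))\<^sup>2))) \<longlongrightarrow> 0)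
      (finite_subsets_at_top UNIV)"
    by simp
  have "\<forall>\<^sub>F X in finite_subsets_at_top UNIV. norm ((\<Sum>\<alpha>\<in>X. hcoef f \<alpha> * \<phi> (monomial0 \<alpha>)) - \<phi> f) \<le>
      \<bar>C\<bar> * sqrt ((hardy_norm f)\<^sup>2 - (\<Sum>\<alpha>\<in>X. (cmod (hcoef f \<alpha>))\<^sup>2))"
  proof (rule eventually_finite_subsets_at_top_weakI)
    fix X :: "('n \<Rightarrow> nat) set" assume X: "finite X"
    from P[OF X] have "(\<Sum>\<alpha>\<in>X. hcoef f \<alpha> * \<phi> (monomial0 \<alpha>)) = \<phi> (P X)" by metis
    thus "norm ((\<Sum>\<alpha>\<in>X. hcoef f \<alpha> * \<phi> (monomial0 \<alpha>)) - \<phi> f) \<le>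
        \<bar>C\<bar> * sqrt ((hardy_norm f)\<^sup>2 - (\<Sum>\<alpha>\<in>X. (cmod (hcoef f \<alpha>))\<^sup>2))"
      using err[OF X] by (simp only:)
  qed
  hence "((\<lambda>X. (\<Sum>\<alpha>\<in>X. hcoef f \<alpha> * \<phi> (monomial0 \<alpha>)) - \<phi> f) \<longlongrightarrow> 0) (finite_subsets_at_top UNIV)"
    using lim by (rule Lim_null_comparison)
  thus ?thesis unfolding has_sum_def by (rule LIM_zero_cancel)
qed

text \<open>Density of the Szego kernels in functional form. As z varies, the value of \<phi> at the
  kernel of \<open>vcnj z\<close> is a power series in z with coefficients \<phi>(monomial); it
  vanishes identically, hence so does \<phi> on monomials, and then on every Taylor
  expansion.\<close>

lemma bounded_functional_zero:
  fixes \<phi> :: "(complex ^ 'n::finite \<Rightarrow> complex) \<Rightarrow> complex"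
  assumes add: "\<And>f g. f \<in> hardy_space \<Longrightarrow> g \<in> hardy_space \<Longrightarrow> \<phi> (\<lambda>z. f z + g z) = \<phi> f + \<phi> g"
    and cmult: "\<And>c f. f \<in> hardy_space \<Longrightarrow> \<phi> (\<lambda>z. c * f z) = c * \<phi> f"
    and bound: "\<And>f. f \<in> hardy_space \<Longrightarrow> cmod (\<phi> f) \<le> C * hardy_norm f"
    and kern: "\<And>w. w \<in> polydisk \<Longrightarrow> \<phi> (kern (\<lambda>_. 0) w) = 0"
    and f: "f \<in> hardy_space"
  shows "\<phi> f = 0"
proof -
  have expansion: "((\<lambda>\<alpha>. hcoef g \<alpha> * \<phi> (monomial0 \<alpha>)) has_sum \<phi> g) UNIV" if "g \<in> hardy_space" for g
    by (rule bounded_functional_has_sum[of \<phi> C]) (use assms that in auto)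
  have "((\<lambda>\<alpha>. \<phi> (monomial0 \<alpha>) * mpow z \<alpha>) has_sum 0) UNIV" if z: "z \<in> polydisk" for z
  proof -
    \<comment> \<open>The kernel is antiholomorphic in its base point; conjugating the point
      produces honest monomials in z.\<close>
    have "hcoef (kern (\<lambda>_. 0) (vcnj z)) \<alpha> = mpow z \<alpha>" for \<alpha>
      using z by (simp add: hcoef_kern mpow_vcnj)
    thus ?thesis using expansion[OF kern_hardy, of "vcnj z" "\<lambda>_. 0"] z by (simp add: kern mult.commute)
  qed
  hence zero: "\<phi> (monomial0 \<alpha>) = 0" for \<alpha> by (rule power_series_zero_unique)
  have "((\<lambda>\<alpha>::'n \<Rightarrow> nat. 0) has_sum \<phi> f) UNIV"
    using expansion[OF f] by (simp only: zero mult_zero_right)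
  thus ?thesis by (rule has_sum_unique[OF _ has_sum_0_simp])
qed

section \<open>Symmetry as an identity between kernels\<close>

text \<open>Writing values as pairings makes linearity of the operator a consequence of linearity of
  the inner product.\<close>

lemma weighted_comp_diff_eq:
  fixes f :: "complex ^ 'n::{finite,linorder} \<Rightarrow> complex"
  assumes "f \<in> hardy_space" "z \<in> polydisk" "V z \<in> polydisk"
  shows "weighted_comp_diff u V k f z = u z * hardy_inner f (kern k (V z))"
  using assms by (simp add: weighted_comp_diff_def hardy_inner_kern)

lemma weighted_comp_diff_outside: "z \<notin> polydisk \<Longrightarrow> weighted_comp_diff u V k f z = 0"
  by (simp add: weighted_comp_diff_def)

text \<open>Conjugate symmetry trades differentiating the Szego kernel at \<open>V z\<close> for
  evaluating the derivative kernel of \<open>V z\<close> at \<open>w\<close>.\<close>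

lemma weighted_comp_diff_szego:
  fixes V :: "complex ^ 'n::{finite,linorder} \<Rightarrow> (complex, 'n) vec"
  assumes w: "w \<in> polydisk" and z: "z \<in> polydisk" and Vz: "V z \<in> polydisk"
  shows "weighted_comp_diff u V k (kern (\<lambda>_. 0) w) z = u z * kern k (vcnj (V z)) (vcnj w)"
proof -
  have "hardy_inner (kern (\<lambda>_. 0) w) (kern k (V z)) = cnj (hardy_inner (kern k (V z)) (kern (\<lambda>_. 0) w))"
    by (intro hardy_inner_cnj kern_hardy w Vz)
  also have "\<dots> = cnj (kern k (V z) w)"
    by (simp add: hardy_inner_szego kern_hardy w Vz)
  also have "\<dots> = std_conjugation (kern k (V z)) (vcnj w)"
    by (simp add: std_conjugation_vcnj)
  also have "\<dots> = kern k (vcnj (V z)) (vcnj w)"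
    by (simp only: std_conjugation_kern)
  finally show ?thesis using assms by (simp add: weighted_comp_diff_eq kern_hardy)
qed

lemma J_symmetric_iff_kernel_identity:
  fixes V :: "complex ^ 'n::{finite,linorder} \<Rightarrow> (complex, 'n) vec"
  assumes V: "\<And>z. z \<in> polydisk \<Longrightarrow> V z \<in> polydisk"
    and bdd: "hardy_bounded (weighted_comp_diff u V k)"
  shows "J_symmetric (weighted_comp_diff u V k) \<longleftrightarrow>
    (\<forall>z\<in>polydisk. \<forall>w\<in>polydisk. u z * kern k (vcnj (V z)) w = u w * kern k (vcnj (V w)) z)"
proof (intro iffI ballI)
  let ?T = "weighted_comp_diff u V k"
  fix z w :: "(complex, 'n) vec"
  assume J: "J_symmetric ?T" and z: "z \<in> polydisk" and w: "w \<in> polydisk"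
  define h where "h = (\<lambda>z. cnj (u w) * kern k (V w) z)"
  have h: "h \<in> hardy_space" unfolding h_def by (intro hardy_space_cmult kern_hardy V w)
  have "hardy_inner (?T f) (kern (\<lambda>_. 0) w) = hardy_inner f h" if f: "f \<in> hardy_space" for f
  proof -
    have "hardy_inner (?T f) (kern (\<lambda>_. 0) w) = ?T f w"
      using bdd f w by (intro hardy_inner_szego) (auto simp: hardy_bounded_def)
    also have "\<dots> = hardy_inner f h"
      unfolding h_def using f w V by (simp add: weighted_comp_diff_eq hardy_inner_cmult_right kern_hardy)
    finally show ?thesis .
  qed
  hence adj: "hardy_adjoint ?T (kern (\<lambda>_. 0) w) = h"
    by (intro hardy_adjoint_eqI h)
  \<comment> \<open>The test kernel is based at \<open>vcnj w\<close> because the inner conjugation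
    moves it to \<open>w\<close>, where the adjoint has just been computed.\<close>
  have "?T (kern (\<lambda>_. 0) (vcnj w)) = std_conjugation (hardy_adjoint ?T (std_conjugation (kern (\<lambda>_. 0) (vcnj w))))"
    using J w by (auto simp: J_symmetric_def kern_hardy)
  hence "?T (kern (\<lambda>_. 0) (vcnj w)) z = std_conjugation h z"
    by (simp add: std_conjugation_kern adj)
  also have "\<dots> = u w * std_conjugation (kern k (V w)) z"
    by (simp add: h_def std_conjugation_vcnj)
  finally show "u z * kern k (vcnj (V z)) w = u w * kern k (vcnj (V w)) z"
    using w z V by (simp add: weighted_comp_diff_szego std_conjugation_kern)
next
  let ?T = "weighted_comp_diff u V k"
  let ?J = "std_conjugation :: ((complex, 'n) vec \<Rightarrow> complex) \<Rightarrow> _"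
  assume sym: "\<forall>z\<in>polydisk. \<forall>w\<in>polydisk. u z * kern k (vcnj (V z)) w = u w * kern k (vcnj (V w)) z"
  obtain C where T: "\<And>f. f \<in> hardy_space \<Longrightarrow> ?T f \<in> hardy_space"
    and C: "\<And>f. f \<in> hardy_space \<Longrightarrow> hardy_norm (?T f) \<le> C * hardy_norm f"
    using bdd by (auto simp: hardy_bounded_def)
  show "J_symmetric ?T"
    unfolding J_symmetric_def
  proof
    fix f :: "(complex, 'n) vec \<Rightarrow> complex" assume f: "f \<in> hardy_space"
    note Jf = std_conjugation_hardy[OF f] and JTf = std_conjugation_hardy[OF T[OF f]]
    \<comment> \<open>\<phi> measures the failure of \<open>?J (?T f)\<close> to be the adjoint
      value at \<open>?J f\<close>. It is linear, bounded by Cauchy-Schwarz, and remains to be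
      killed on the Szego kernels.\<close>
    define \<phi> where "\<phi> = (\<lambda>F. hardy_inner (?T F) (?J f) - hardy_inner F (?J (?T f)))"
    have "\<phi> F = 0" if F: "F \<in> hardy_space" for F
    proof (rule bounded_functional_zero[OF _ _ _ _ F])
      fix G H :: "(complex, 'n) vec \<Rightarrow> complex" assume GH: "G \<in> hardy_space" "H \<in> hardy_space"
      have "?T (\<lambda>z. G z + H z) = (\<lambda>z. ?T G z + ?T H z)"
      proof
        fix z show "?T (\<lambda>z. G z + H z) z = ?T G z + ?T H z"
          by (cases "z \<in> polydisk")
             (simp_all add: weighted_comp_diff_outside weighted_comp_diff_eq V GH hardy_space_add
               hardy_inner_add_left kern_hardy distrib_left)
      qed
      thus "\<phi> (\<lambda>z. G z + H z) = \<phi> G + \<phi> H"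
        by (simp add: \<phi>_def hardy_inner_add_left GH T Jf JTf)
    next
      fix c :: complex and G :: "(complex, 'n) vec \<Rightarrow> complex" assume G: "G \<in> hardy_space"
      have "?T (\<lambda>z. c * G z) = (\<lambda>z. c * ?T G z)"
      proof
        fix z show "?T (\<lambda>z. c * G z) z = c * ?T G z"
          by (cases "z \<in> polydisk")
             (simp_all add: weighted_comp_diff_outside weighted_comp_diff_eq V G hardy_space_cmult
               hardy_inner_cmult_left kern_hardy)
      qed
      thus "\<phi> (\<lambda>z. c * G z) = c * \<phi> G"
        by (simp add: \<phi>_def hardy_inner_cmult_left G T Jf JTf right_diff_distrib)
    next
      fix G :: "(complex, 'n) vec \<Rightarrow> complex" assume G: "G \<in> hardy_space"
      have "cmod (\<phi> G) \<le> cmod (hardy_inner (?T G) (?J f)) + cmod (hardy_inner G (?J (?T f)))"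
        unfolding \<phi>_def by (rule norm_triangle_ineq4)
      also have "\<dots> \<le> hardy_norm (?T G) * hardy_norm (?J f) + hardy_norm G * hardy_norm (?J (?T f))"
        by (intro add_mono hardy_Cauchy_Schwarz T G Jf JTf)
      also have "\<dots> \<le> (C * hardy_norm G) * hardy_norm (?J f) + hardy_norm G * hardy_norm (?J (?T f))"
        by (intro add_mono mult_right_mono C G hardy_norm_nonneg order_refl)
      also have "\<dots> = (C * hardy_norm (?J f) + hardy_norm (?J (?T f))) * hardy_norm G"
        by (simp add: algebra_simps)
      finally show "cmod (\<phi> G) \<le> (C * hardy_norm (?J f) + hardy_norm (?J (?T f))) * hardy_norm G" .
    next
      fix w :: "(complex, 'n) vec" assume w: "w \<in> polydisk"
      define w' where "w' = vcnj w"
      have w': "w' \<in> polydisk" "V w' \<in> polydisk" using w V by (simp_all add: w'_def)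
      \<comment> \<open>The assumed identity swaps the variable with the base point and so turns the
        image of a Szego kernel into a multiple of one derivative kernel.\<close>
      have "?T (kern (\<lambda>_. 0) w) = (\<lambda>z. u w' * kern k (vcnj (V w')) z)"
      proof
        fix z show "?T (kern (\<lambda>_. 0) w) z = u w' * kern k (vcnj (V w')) z"
        proof (cases "z \<in> polydisk")
          case True
          thus ?thesis using sym w w' V by (simp add: weighted_comp_diff_szego w'_def)
        next
          case False
          thus ?thesis by (simp add: weighted_comp_diff_outside kern_def)
        qed
      qed
      hence "hardy_inner (?T (kern (\<lambda>_. 0) w)) (?J f) = u w' * hardy_inner (?J (kern k (V w'))) (?J f)"
        using w' Jf by (simp add: hardy_inner_cmult_left kern_hardy std_conjugation_kern)
      also have "\<dots> = u w' * hardy_inner f (kern k (V w'))"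
        using w' f by (simp add: hardy_inner_std_conjugation kern_hardy hardy_inner_cnj[of f])
      also have "\<dots> = ?T f w'" using f w' by (simp add: weighted_comp_diff_eq)
      finally have 1: "hardy_inner (?T (kern (\<lambda>_. 0) w)) (?J f) = ?T f w'" .
      have "hardy_inner (kern (\<lambda>_. 0) w) (?J (?T f)) = cnj (?J (?T f) w)"
        using hardy_inner_cnj[OF JTf kern_hardy[OF w]] by (simp add: hardy_inner_szego JTf w)
      also have "\<dots> = ?T f w'" by (simp add: std_conjugation_vcnj w'_def)
      finally show "\<phi> (kern (\<lambda>_. 0) w) = 0" using 1 by (simp add: \<phi>_def)
    qed
    hence "hardy_adjoint ?T (?J f) = ?J (?T f)"
      by (intro hardy_adjoint_eqI JTf) (simp add: \<phi>_def)
    thus "?T f = ?J (hardy_adjoint ?T (?J f))" by simp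
  qed
qed

section \<open>The constant in front of the weight\<close>

lemma mpow_0: "mpow 0 \<alpha> = (if \<alpha> = (\<lambda>_. 0) then 1 else 0)"
  by (auto simp: mpow_def fun_eq_iff)

text \<open>Only the exponent k survives at 0: a smaller entry has a zero binomial, and otherwise a
  larger entry leaves a positive power of 0. The factorials are squared because one product sits in
  the coefficient of the kernel and a second one comes from differentiation.\<close>

lemma mixed_partial_kern_0:
  fixes w :: "complex ^ 'n::{finite,linorder}"
  assumes w: "w \<in> polydisk" and u: "\<And>z. z \<in> polydisk \<Longrightarrow> u z = A * kern k w z"
  shows "mixed_partial k u 0 = A * (\<Prod>i\<in>UNIV. fact (k i))\<^sup>2"
proof (rule has_sum_unique)
  define b where "b = (\<lambda>\<alpha>. A * ((\<Prod>i\<in>UNIV. fact (k i) * of_nat (\<alpha> i choose k i)) * cnj (mpow w (\<lambda>i. \<alpha> i - k i))))"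
  have "((\<lambda>\<alpha>. b \<alpha> * mpow z \<alpha>) has_sum u z) UNIV" if z: "z \<in> polydisk" for z
    using has_sum_cmult_right[OF kern_has_sum[OF w z], of A] u[OF z] by (simp add: b_def mult.assoc)
  thus "((\<lambda>\<alpha>. b \<alpha> * (\<Prod>i\<in>UNIV. fact (k i) * of_nat (\<alpha> i choose k i)) * mpow 0 (\<lambda>i. \<alpha> i - k i)) has_sum mixed_partial k u 0) UNIV"
    by (rule mixed_partial_has_sum[where \<gamma> = "\<lambda>\<alpha>. \<alpha>"]) (auto simp: polydisk_iff)
  show "((\<lambda>\<alpha>. b \<alpha> * (\<Prod>i\<in>UNIV. fact (k i) * of_nat (\<alpha> i choose k i)) * mpow 0 (\<lambda>i. \<alpha> i - k i)) has_sum
      A * (\<Prod>i\<in>UNIV. fact (k i))\<^sup>2) UNIV"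
  proof (rule has_sum_finite_neutralI[of "{k}"])
    fix \<alpha> assume "\<alpha> \<in> UNIV - {k}"
    then obtain i where i: "\<alpha> i \<noteq> k i" by (auto simp: fun_eq_iff)
    show "b \<alpha> * (\<Prod>i\<in>UNIV. fact (k i) * of_nat (\<alpha> i choose k i)) * mpow 0 (\<lambda>i. \<alpha> i - k i) = 0"
    proof (cases "\<alpha> i < k i")
      case True
      hence "(\<Prod>i\<in>UNIV. fact (k i) * of_nat (\<alpha> i choose k i) :: complex) = 0"
        by (intro prod_zero) (auto intro!: bexI[of _ i] simp: binomial_eq_0)
      thus ?thesis by simp
    next
      case False
      hence "(\<lambda>i. \<alpha> i - k i) \<noteq> (\<lambda>_. 0)" using i by (auto simp: fun_eq_iff intro!: exI[of _ i])
      thus ?thesis by (simp add: mpow_0)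
    qed
  qed (auto simp: b_def mpow_def power2_eq_square)
qed

section \<open>Solving the kernel identity\<close>

text \<open>The factorials are common to both sides, and \<open>vcnj\<close> undoes the conjugation
  built into \<open>kern\<close>.\<close>

lemma kernel_identity_normalize:
  fixes V :: "complex ^ 'n::{finite,linorder} \<Rightarrow> complex ^ 'n::{finite,linorder}"
  assumes "z \<in> polydisk" "w \<in> polydisk"
  shows "u z * kern k (vcnj (V z)) w = u w * kern k (vcnj (V w)) z \<longleftrightarrow>
    u z * (\<Prod>i\<in>UNIV. w $ i ^ k i / (1 - V z $ i * w $ i) ^ (k i + 1)) =
    u w * (\<Prod>i\<in>UNIV. z $ i ^ k i / (1 - V w $ i * z $ i) ^ (k i + 1))"
  using assms by (simp only: kern_def prod.distrib vcnj_nth complex_cnj_cnj if_True mult.left_commute[of "u _"]) simp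

text \<open>Differentiate both powers in \<omega> at 0. The bases agree there with value 1 - c
  \<zeta>, so the chain rule gives the same nonzero factor on both sides; what remains is (1 - c
  \<zeta>) v(\<zeta>) = c (1 - c \<zeta>) + d \<zeta>.\<close>

lemma fractional_linear_of_power_identity:
  fixes v :: "complex \<Rightarrow> complex"
  assumes holo: "v holomorphic_on ball 0 1" and c: "c = v 0" "cmod c < 1" and d: "d = deriv v 0"
    and \<zeta>: "\<zeta> \<in> ball 0 1"
    and eq: "\<And>\<omega>. \<omega> \<in> ball 0 1 \<Longrightarrow> \<omega> \<noteq> 0 \<Longrightarrow>
      ((1 - c * \<zeta>) * (1 - v \<zeta> * \<omega>)) ^ (n + 1) = ((1 - c * \<omega>) * (1 - v \<omega> * \<zeta>)) ^ (n + 1)"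
  shows "v \<zeta> = ((d - c\<^sup>2) * \<zeta> + c) / (1 - c * \<zeta>)"
proof -
  have ne: "1 - c * \<zeta> \<noteq> 0" using c \<zeta> by (intro one_minus_mult_ne_0) auto
  have dv: "(v has_field_derivative d) (at 0)"
    unfolding d by (rule holomorphic_derivI[OF holo]) auto
  have "((\<lambda>\<omega>. (1 - c * \<zeta>) * (1 - v \<zeta> * \<omega>)) has_field_derivative (1 - c * \<zeta>) * (- v \<zeta>)) (at 0)"
    by (auto intro!: derivative_eq_intros)
  from DERIV_power[OF this, of "n + 1"]
  have "((\<lambda>\<omega>. ((1 - c * \<zeta>) * (1 - v \<zeta> * \<omega>)) ^ (n + 1)) has_field_derivative
      of_nat (n + 1) * (1 - c * \<zeta>) ^ n * ((1 - c * \<zeta>) * (- v \<zeta>))) (at 0)"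
    by (simp add: mult_ac del: of_nat_Suc of_nat_add)
  moreover have "((\<lambda>\<omega>. ((1 - c * \<zeta>) * (1 - v \<zeta> * \<omega>)) ^ (n + 1)) has_field_derivative
      of_nat (n + 1) * (1 - c * \<zeta>) ^ n * (- c * (1 - c * \<zeta>) - d * \<zeta>)) (at 0)"
  proof (rule has_field_derivative_transform_within_open)
    have "((\<lambda>\<omega>. (1 - c * \<omega>) * (1 - v \<omega> * \<zeta>)) has_field_derivative - c * (1 - c * \<zeta>) - d * \<zeta>) (at 0)"
      using c by (auto intro!: derivative_eq_intros dv)
    from DERIV_power[OF this, of "n + 1"]
    show "((\<lambda>\<omega>. ((1 - c * \<omega>) * (1 - v \<omega> * \<zeta>)) ^ (n + 1)) has_field_derivative
        of_nat (n + 1) * (1 - c * \<zeta>) ^ n * (- c * (1 - c * \<zeta>) - d * \<zeta>)) (at 0)"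
      using c by (simp add: mult_ac del: of_nat_Suc of_nat_add)
    \<comment> \<open>The hypothesis excludes \<omega> = 0, but there both sides equal (1 - c
      \<zeta>)^(n + 1) because v(0) = c.\<close>
    show "((1 - c * \<omega>) * (1 - v \<omega> * \<zeta>)) ^ (n + 1) = ((1 - c * \<zeta>) * (1 - v \<zeta> * \<omega>)) ^ (n + 1)"
      if "\<omega> \<in> ball 0 1" for \<omega>
      using eq[OF that] c by (cases "\<omega> = 0") auto
  qed auto
  ultimately have "of_nat (n + 1) * (1 - c * \<zeta>) ^ n * ((1 - c * \<zeta>) * (- v \<zeta>)) =
      of_nat (n + 1) * (1 - c * \<zeta>) ^ n * (- c * (1 - c * \<zeta>) - d * \<zeta>)"
    by (rule DERIV_unique)
  moreover have "of_nat (n + 1) * (1 - c * \<zeta>) ^ n \<noteq> 0"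
    using ne by (simp del: of_nat_add of_nat_Suc add: of_nat_eq_0_iff)
  ultimately have "(1 - c * \<zeta>) * (- v \<zeta>) = - c * (1 - c * \<zeta>) - d * \<zeta>"
    using mult_left_cancel by blast
  hence "(1 - c * \<zeta>) * v \<zeta> = (d - c\<^sup>2) * \<zeta> + c"
    by (simp add: algebra_simps power2_eq_square)
  thus ?thesis using ne by (simp add: field_simps)
qed

lemma kernel_identity_iff:
  fixes u :: "complex ^ 'n::{finite,linorder} \<Rightarrow> complex" and v :: "'n \<Rightarrow> complex \<Rightarrow> complex"
  assumes nz: "\<exists>z\<in>polydisk. u z \<noteq> 0"
    and holo: "\<And>j. v j holomorphic_on ball 0 1"
    and self: "\<And>j. v j ` ball 0 1 \<subseteq> ball 0 1"
    and a: "a = mixed_partial k u 0 / (\<Prod>i\<in>UNIV. fact (k i))"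
    and c: "\<And>j. c j = v j 0"
    and d: "\<And>j. d j = deriv (v j) 0"
  shows "(\<forall>z\<in>polydisk. \<forall>w\<in>polydisk.
      u z * (\<Prod>i\<in>UNIV. w $ i ^ k i / (1 - v i (z $ i) * w $ i) ^ (k i + 1)) =
      u w * (\<Prod>i\<in>UNIV. z $ i ^ k i / (1 - v i (w $ i) * z $ i) ^ (k i + 1))) \<longleftrightarrow>
    (\<forall>z\<in>polydisk. u z = a * (\<Prod>i\<in>UNIV. (z $ i) ^ k i / (1 - c i * z $ i) ^ (k i + 1))) \<and>
    (\<forall>j. \<forall>\<zeta>\<in>ball 0 1. v j \<zeta> = ((d j - (c j)\<^sup>2) * \<zeta> + c j) / (1 - c j * \<zeta>))"
    (is "?S \<longleftrightarrow> ?U \<and> ?V")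
proof -
  have v1: "cmod (v j \<zeta>) < 1" if "cmod \<zeta> < 1" for j \<zeta>
    using self[of j] that by (auto simp: image_subset_iff)
  have c1: "cmod (c j) < 1" for j unfolding c by (rule v1) simp
  have ne_v: "1 - v j \<zeta> * \<omega> \<noteq> 0" if "cmod \<zeta> < 1" "cmod \<omega> < 1" for j \<zeta> \<omega>
    using that v1 by (intro one_minus_mult_ne_0) auto
  have ne_c: "1 - c j * \<omega> \<noteq> 0" if "cmod \<omega> < 1" for j \<omega>
    using that c1 by (intro one_minus_mult_ne_0) auto
  define P where "P = (\<lambda>z. \<Prod>i\<in>UNIV. (z $ i) ^ k i / (1 - c i * z $ i) ^ (k i + 1))"
  \<comment> \<open>The contribution of one coordinate after multiplication by \<open>P\<close>.
    Once u is a multiple of \<open>P\<close>, the kernel identity is a statement about swapping the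
    arguments of the \<open>g i\<close>.\<close>
  define g where "g = (\<lambda>i x y. x ^ k i * y ^ k i / ((1 - c i * x) * (1 - v i x * y)) ^ (k i + 1))"
  have g: "P z * (\<Prod>i\<in>UNIV. w $ i ^ k i / (1 - v i (z $ i) * w $ i) ^ (k i + 1)) = (\<Prod>i\<in>UNIV. g i (z $ i) (w $ i))" for z w
    unfolding P_def g_def prod.distrib[symmetric] by (intro prod.cong refl) (simp only: times_divide_times_eq power_mult_distrib)
  show ?thesis
  proof
    assume UV: "?U \<and> ?V"
    have sym: "g i x y = g i y x" if "cmod x < 1" "cmod y < 1" for i x y
    proof -
      have "(1 - c i * x) * (1 - v i x * y) = 1 - c i * x - c i * y - (d i - (c i)\<^sup>2) * x * y"
        if "cmod x < 1" for x y
      proof -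
        have v: "(1 - c i * x) * v i x = (d i - (c i)\<^sup>2) * x + c i"
          using UV that ne_c[OF that, of i] by simp
        have "(1 - c i * x) * (1 - v i x * y) = 1 - c i * x - ((1 - c i * x) * v i x) * y"
          by (simp add: algebra_simps)
        also have "\<dots> = 1 - c i * x - c i * y - (d i - (c i)\<^sup>2) * x * y"
          unfolding v by (simp add: algebra_simps)
        finally show ?thesis .
      qed
      from this[of x y] this[of y x] that show ?thesis
        by (simp add: g_def mult.commute mult.left_commute diff_diff_eq add.commute)
    qed
    show ?S
    proof (intro ballI)
      fix z w :: "(complex, 'n) vec" assume z: "z \<in> polydisk" and w: "w \<in> polydisk"
      have "(\<Prod>i\<in>UNIV. g i (z $ i) (w $ i)) = (\<Prod>i\<in>UNIV. g i (w $ i) (z $ i))"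
        using z w by (intro prod.cong refl sym) (auto simp: polydisk_iff)
      moreover have "u z = a * P z" "u w = a * P w" using UV z w by (simp_all add: P_def)
      ultimately show "u z * (\<Prod>i\<in>UNIV. w $ i ^ k i / (1 - v i (z $ i) * w $ i) ^ (k i + 1)) =
          u w * (\<Prod>i\<in>UNIV. z $ i ^ k i / (1 - v i (w $ i) * z $ i) ^ (k i + 1))"
        by (simp only: mult.assoc g)
    qed
  next
    assume S: ?S
    \<comment> \<open>On the diagonal with t > 0 all monomial factors collapse to the single nonzero
      number t^|k|. \<open>L\<close> is the left-hand side divided by it, and \<open>Q\<close> is
      the factor of u(t,...,t) on the right.\<close>
    define w where "w = (\<lambda>t::real. (\<chi> i. complex_of_real t) :: (complex, 'n) vec)"
    define L where "L = (\<lambda>t z. u z * (\<Prod>i\<in>UNIV. 1 / (1 - v i (z $ i) * of_real t) ^ (k i + 1)))"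
    define Q where "Q = (\<lambda>t z. \<Prod>i\<in>UNIV. z $ i ^ k i / (1 - v i (of_real t) * z $ i) ^ (k i + 1))"
    have LQ: "L t z = u (w t) / of_real t ^ sum k UNIV * Q t z" if "z \<in> polydisk" "t \<in> {0<..<1}" for t z
    proof -
      have wn: "w t $ i = of_real t" for i by (simp add: w_def)
      have wt: "w t \<in> polydisk" using that by (simp add: w_def polydisk_iff)
      have "of_real t ^ sum k UNIV * L t z = u z * (\<Prod>i\<in>UNIV. w t $ i ^ k i / (1 - v i (z $ i) * w t $ i) ^ (k i + 1))"
        by (simp add: L_def w_def power_sum prod_dividef)
      also have "\<dots> = u (w t) * Q t z"
        using S[rule_format, OF that(1) wt] unfolding Q_def by (simp only: wn)
      finally show ?thesis using that by (simp add: field_simps)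
    qed
    have L: "((\<lambda>t. L t z) \<longlongrightarrow> u z) (at_right 0)" for z
    proof -
      have "((\<lambda>t. L t z) \<longlongrightarrow> u z * (\<Prod>i\<in>UNIV. 1 / (1 - v i (z $ i) * of_real 0) ^ (k i + 1))) (at_right 0)"
        unfolding L_def by (intro tendsto_intros) auto
      thus ?thesis by simp
    qed
    have Q: "((\<lambda>t. Q t z) \<longlongrightarrow> P z) (at_right 0)" if z: "z \<in> polydisk" for z
    proof -
      have "((\<lambda>t. v i (of_real t)) \<longlongrightarrow> c i) (at_right 0)" for i
      proof -
        have "isCont (v i) 0"
          using holomorphic_on_imp_continuous_on[OF holo[of i]] by (simp add: continuous_on_eq_continuous_at)
        hence "isCont (v i) (of_real 0)" by simp
        moreover have "((\<lambda>t::real. complex_of_real t) \<longlongrightarrow> of_real 0) (at_right 0)" by (intro tendsto_intros)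
        ultimately show ?thesis using isCont_tendsto_compose c[of i] by fastforce
      qed
      moreover have "1 - c i * z $ i \<noteq> 0" for i using z by (intro ne_c) (simp add: polydisk_iff)
      ultimately show ?thesis unfolding Q_def P_def by (intro tendsto_intros) auto
    qed
    \<comment> \<open>All coordinates are nonzero, hence \<open>P z0\<close> is nonzero and the
      quotient of \<open>L\<close> and \<open>Q\<close> at this point shows that u(t,...,t) / t^|k|
      has a limit, the constant \<open>A\<close>.\<close>
    define z0 where "z0 = ((\<chi> i. 1 / 2) :: (complex, 'n) vec)"
    have z0: "z0 \<in> polydisk" by (simp add: z0_def polydisk_iff)
    have Pz0: "P z0 \<noteq> 0" using ne_c[of "1/2"] by (simp add: P_def z0_def)
    define A where "A = u z0 / P z0"
    have ev: "\<forall>\<^sub>F t in at_right (0::real). t \<in> {0<..<1}"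
      by (rule eventually_at_right_real) simp
    have "((\<lambda>t. L t z0 / Q t z0) \<longlongrightarrow> A) (at_right 0)"
      unfolding A_def by (intro tendsto_divide L Q z0 Pz0)
    moreover have "\<forall>\<^sub>F t in at_right 0. L t z0 / Q t z0 = u (w t) / of_real t ^ sum k UNIV"
      using ev tendsto_imp_eventually_ne[OF Q[OF z0] Pz0] by eventually_elim (simp add: LQ z0)
    ultimately have lim: "((\<lambda>t. u (w t) / of_real t ^ sum k UNIV) \<longlongrightarrow> A) (at_right 0)"
      by (rule Lim_transform_eventually)
    have u: "u z = A * P z" if z: "z \<in> polydisk" for z
    proof (rule tendsto_unique)
      show "((\<lambda>t. L t z) \<longlongrightarrow> u z) (at_right 0)" by (rule L)
      have "((\<lambda>t. u (w t) / of_real t ^ sum k UNIV * Q t z) \<longlongrightarrow> A * P z) (at_right 0)"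
        by (intro tendsto_mult lim Q z)
      moreover have "\<forall>\<^sub>F t in at_right 0. u (w t) / of_real t ^ sum k UNIV * Q t z = L t z"
        using ev by eventually_elim (simp add: LQ z)
      ultimately show "((\<lambda>t. L t z) \<longlongrightarrow> A * P z) (at_right 0)"
        by (rule Lim_transform_eventually)
    qed simp
    \<comment> \<open>Needed later to cancel the weight from the kernel identity; this is where u
      being nonzero enters.\<close>
    have A: "A \<noteq> 0" using nz u by auto
    define F where "F = (\<Prod>i\<in>UNIV. fact (k i) :: complex)"
    have F: "F \<noteq> 0" by (simp add: F_def)
    \<comment> \<open>Conjugated because \<open>kern\<close> conjugates its base point; thus
      \<open>P\<close> is a derivative kernel up to factorials and
      \<open>mixed_partial_kern_0\<close> identifies \<open>A\<close>.\<close>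
    define cv where "cv = vcnj (\<chi> i. c i)"
    have cv: "cv \<in> polydisk" by (simp add: cv_def polydisk_iff c1)
    have cv_nth: "cnj (cv $ i) = c i" for i by (simp add: cv_def)
    have "u z = A / F * kern k cv z" if z: "z \<in> polydisk" for z
    proof -
      have "kern k cv z = F * P z"
        using z by (simp only: kern_def if_True prod.distrib F_def P_def cv_nth)
      thus ?thesis using u[OF z] F by simp
    qed
    hence "mixed_partial k u 0 = A / F * F\<^sup>2"
      unfolding F_def by (rule mixed_partial_kern_0[OF cv])
    hence aA: "a = A" using F by (simp add: a F_def[symmetric] power2_eq_square)
    have "v j \<zeta> = ((d j - (c j)\<^sup>2) * \<zeta> + c j) / (1 - c j * \<zeta>)" if \<zeta>: "\<zeta> \<in> ball 0 1" for j \<zeta>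
    \<comment> \<open>Separated because \<zeta>^(k j) is cancelled below; at 0 the formula just says
      v_j(0) = c_j.\<close>
    proof (cases "\<zeta> = 0")
      case True
      thus ?thesis using c by simp
    next
      case False
      show ?thesis
      proof (rule fractional_linear_of_power_identity[where n = "k j", OF holo c c1 d \<zeta>])
        fix \<omega> :: complex assume \<omega>: "\<omega> \<in> ball 0 1" "\<omega> \<noteq> 0"
        \<comment> \<open>The two points differ only in coordinate \<open>j\<close>. The other
          factors are all \<open>g i (1/2) (1/2)\<close>, equal on both sides and nonzero, so
          cancelling them leaves a one-variable identity.\<close>
        define x where "x = upd z0 j \<zeta>"
        define y where "y = upd z0 j \<omega>"
        have xy: "x \<in> polydisk" "y \<in> polydisk"
          using z0 \<zeta> \<omega> by (auto simp: x_def y_def intro: upd_in_polydisk)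
        have "A * (\<Prod>i\<in>UNIV. g i (x $ i) (y $ i)) = A * (\<Prod>i\<in>UNIV. g i (y $ i) (x $ i))"
          using S[rule_format, OF xy] u[OF xy(1)] u[OF xy(2)] by (simp only: mult.assoc g)
        hence "(\<Prod>i\<in>UNIV. g i (x $ i) (y $ i)) = (\<Prod>i\<in>UNIV. g i (y $ i) (x $ i))"
          using A by simp
        moreover have "(\<Prod>i\<in>UNIV. g i (x $ i) (y $ i)) = g j \<zeta> \<omega> * (\<Prod>i\<in>UNIV - {j}. g i (1/2) (1/2))"
          by (subst prod.remove[of UNIV j]) (auto simp: x_def y_def z0_def intro!: prod.cong)
        moreover have "(\<Prod>i\<in>UNIV. g i (y $ i) (x $ i)) = g j \<omega> \<zeta> * (\<Prod>i\<in>UNIV - {j}. g i (1/2) (1/2))"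
          by (subst prod.remove[of UNIV j]) (auto simp: x_def y_def z0_def intro!: prod.cong)
        moreover have "(\<Prod>i\<in>UNIV - {j}. g i (1/2) (1/2)) \<noteq> 0"
          using ne_c[of "1/2"] ne_v[of "1/2" "1/2"] by (simp add: g_def)
        ultimately have "g j \<zeta> \<omega> = g j \<omega> \<zeta>" by simp
        moreover have "\<zeta> ^ k j * \<omega> ^ k j \<noteq> 0" using False \<omega> by simp
        moreover have "((1 - c j * \<zeta>) * (1 - v j \<zeta> * \<omega>)) ^ (k j + 1) \<noteq> 0"
            "((1 - c j * \<omega>) * (1 - v j \<omega> * \<zeta>)) ^ (k j + 1) \<noteq> 0"
          using \<zeta> \<omega> ne_c ne_v by simp_all
        ultimately show "((1 - c j * \<zeta>) * (1 - v j \<zeta> * \<omega>)) ^ (k j + 1) = ((1 - c j * \<omega>) * (1 - v j \<omega> * \<zeta>)) ^ (k j + 1)"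
          unfolding g_def mult.commute[of "\<omega> ^ k j" "\<zeta> ^ k j"] by (metis divide_cancel_left)
      qed
    qed
    thus "?U \<and> ?V" using u by (simp add: aA P_def)
  qed
qed

theorem theorem2p2:
  fixes k :: "'n::{finite,linorder} \<Rightarrow> nat"
    and u :: "complex ^ 'n::{finite,linorder} \<Rightarrow> complex"
    and v :: "'n \<Rightarrow> complex \<Rightarrow> complex"
    and a :: complex
    and c d :: "'n \<Rightarrow> complex"
  assumes "analytic_polydisk u"
    and "\<exists>z\<in>polydisk. u z \<noteq> 0"
    and "\<And>j. v j holomorphic_on ball 0 1"
    and "\<And>j. v j ` ball 0 1 \<subseteq> ball 0 1"
    and "hardy_bounded (weighted_comp_diff u (\<lambda>z. \<chi> j. v j (z $ j)) k)"
    and "a = mixed_partial k u 0 / (\<Prod>i\<in>UNIV. fact (k i))"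
    and "\<And>j. c j = v j 0"
    and "\<And>j. d j = deriv (v j) 0"
  shows "J_symmetric (weighted_comp_diff u (\<lambda>z. \<chi> j. v j (z $ j)) k) \<longleftrightarrow>
    (\<forall>z\<in>polydisk. u z = a * (\<Prod>i\<in>UNIV. (z $ i) ^ k i / (1 - c i * z $ i) ^ (k i + 1))) \<and>
    (\<forall>j. \<forall>\<zeta>\<in>ball 0 1. v j \<zeta> = ((d j - (c j)\<^sup>2) * \<zeta> + c j) / (1 - c j * \<zeta>))"
proof -
  have V: "(\<chi> j. v j (z $ j)) \<in> polydisk" if "z \<in> polydisk" for z
    using that assms(4) by (fastforce simp: polydisk_def)
  have N: "u z * kern k (vcnj (\<chi> j. v j (z $ j))) w = u w * kern k (vcnj (\<chi> j. v j (w $ j))) z \<longleftrightarrow>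
      u z * (\<Prod>i\<in>UNIV. w $ i ^ k i / (1 - v i (z $ i) * w $ i) ^ (k i + 1)) =
      u w * (\<Prod>i\<in>UNIV. z $ i ^ k i / (1 - v i (w $ i) * z $ i) ^ (k i + 1))"
    if "z \<in> polydisk" "w \<in> polydisk" for z w
    using kernel_identity_normalize[OF that, of u k "\<lambda>z. \<chi> j. v j (z $ j)"] by (simp only: vec_lambda_beta)
  have "J_symmetric (weighted_comp_diff u (\<lambda>z. \<chi> j. v j (z $ j)) k) \<longleftrightarrow>
      (\<forall>z\<in>polydisk. \<forall>w\<in>polydisk.
        u z * kern k (vcnj (\<chi> j. v j (z $ j))) w = u w * kern k (vcnj (\<chi> j. v j (w $ j))) z)"
    by (rule J_symmetric_iff_kernel_identity[OF V assms(5)])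
  also have "\<dots> \<longleftrightarrow> (\<forall>z\<in>polydisk. \<forall>w\<in>polydisk.
      u z * (\<Prod>i\<in>UNIV. w $ i ^ k i / (1 - v i (z $ i) * w $ i) ^ (k i + 1)) =
      u w * (\<Prod>i\<in>UNIV. z $ i ^ k i / (1 - v i (w $ i) * z $ i) ^ (k i + 1)))"
    by (intro ball_cong refl N)
  also note kernel_identity_iff[OF assms(2-4,6-8)]
  finally show ?thesis .
qed

end
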